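(* Let $n\ge2$ and let $\Omega$ be an open proper subset of $\mathbb{R}^n$ having the outer regularity property with constant $b>0$. Let $\delta\in(0,n]$, $\kappa\in[0,1)$ and $p\in(\delta/n,\delta/\kappa)$ (with $\delta/0:=\infty$). Then there exists a constant $c\in(0,\infty)$ depending only on $n,\delta,\kappa,p,b$ such that \[ \int_{\Omega}\frac{|u(x)|^p}{\operatorname{dist}(x,\partial\Omega)^{p(1-\kappa)}}\,d\mathcal{H}_{\infty}^{\delta-\kappa p}\le c\int_{\Omega}|\nabla u(x)|^p\,d\mathcal{H}_{\infty}^{\delta} \] for all $u\in C^1_0(\Omega)$.
   Context: An open proper subset $\Omega\subset\mathbb{R}^n$ has the outer regularity property with constant $b>0$ if $|B(y,r)\setminus\Omega|\ge b|B(y,r)|$ for every $y\in\partial\Omega$ and every $r>0$ ($|\cdot|$ is Lebesgue measure). For $E\subset\mathbb{R}^n$ and $\beta\in(0,n]$, $\mathcal{H}^{\beta}_\infty(E)=\inf\{\sum_i r_i^{\beta}: E\subset\bigcup_i B(x_i,r_i)\}$ over countable or finite coverings by open balls. For $f:\Omega\to[0,\infty]$, $\int_\Omega f\,d\mathcal{H}^{\beta}_\infty:=\int_0^\infty \mathcal{H}^{\beta}_\infty(\{x\in\Omega: f(x)>t\})\,dt$. $C^1_0(\Omega)$ denotes continuously differentiable functions with compact support in $\Omega$. *)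

theory Defs
  imports "HOL-Analysis.Analysis"
begin

definition outer_regular :: "'a::euclidean_space set \<Rightarrow> real \<Rightarrow> bool" where
  "outer_regular \<Omega> b \<longleftrightarrow> b > 0 \<and>
     (\<forall>y\<in>frontier \<Omega>. \<forall>r>0.
        measure lebesgue (ball y r - \<Omega>) \<ge> b * measure lebesgue (ball y r))"

text \<open>Hausdorff content of dimension beta, via countable coverings by open balls
  (finite coverings are included by allowing radius 0, i.e. empty balls).\<close>
definition hcontent :: "real \<Rightarrow> 'a::euclidean_space set \<Rightarrow> ennreal" where
  "hcontent \<beta> E = Inf {(\<Sum>i. ennreal (r i powr \<beta>)) | (c :: nat \<Rightarrow> 'a) (r :: nat \<Rightarrow> real).
       (\<forall>i. r i \<ge> 0) \<and> E \<subseteq> (\<Union>i. ball (c i) (r i))}"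

definition choquet_int :: "real \<Rightarrow> 'a::euclidean_space set \<Rightarrow> ('a \<Rightarrow> ennreal) \<Rightarrow> ennreal" where
  "choquet_int \<beta> \<Omega> f =
     (\<integral>\<^sup>+ t. indicator {0<..} t * hcontent \<beta> {x\<in>\<Omega>. f x > ennreal t} \<partial>lborel)"

text \<open>u is in C^1_0(Omega) with gradient D: u (extended by zero) is continuously
  differentiable with gradient D, and its support is a compact subset of Omega.\<close>
definition C1_0_grad :: "'a::euclidean_space set \<Rightarrow> ('a \<Rightarrow> real) \<Rightarrow> ('a \<Rightarrow> 'a) \<Rightarrow> bool" where
  "C1_0_grad \<Omega> u D \<longleftrightarrow> (\<forall>x. GDERIV u x :> D x) \<and> continuous_on UNIV D \<and>
     compact (closure {x. u x \<noteq> 0}) \<and> closure {x. u x \<noteq> 0} \<subseteq> \<Omega>"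

end

theory Submission
  imports Defs
begin

text \<open>Outer regularity gives a pointwise bound of \<open>\<bar>u x\<bar>\<close> by \<open>dist(x, frontier \<Omega>) powr (1 - \<kappa>)\<close> times the
  fractional maximal function of \<open>norm D\<close>, so it suffices to bound that maximal function from
  \<open>L^p(H^\<delta>)\<close> to \<open>L^p(H^(\<delta> - \<kappa> p))\<close>. In both cases below its p-th power is dominated by a weighted sum of
  indicators of balls, and the Choquet integral of such a sum is at most a constant times the sum of
  weight times radius to the power \<open>\<delta> - \<kappa> p\<close>. For \<open>\<delta> < n\<close> the balls are dyadic dilates of nearly optimal
  coverings of the level sets of \<open>norm D\<close>; for \<open>\<delta> = n\<close>, where \<open>p > 1\<close>, they come from the Vitali covering
  lemma applied to the balls on which \<open>norm D\<close> has large mean.\<close>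

section \<open>Hausdorff content and dyadic cells\<close>

text \<open>For a general monotone set function the Choquet integral is not subadditive, so bounds
  for the pieces of a sum cannot simply be added. Dyadic cells restore subadditivity up to constants
  because they are nested or disjoint, and a ball can be traded for boundedly many of them. What
  then decides the proof is the cost of the dominating balls. Dilating a covering ball by
  \<open>2 ^ m\<close> multiplies its cost by a constant times
  \<open>2 powr (m * (\<delta> - n * q))\<close>, where \<open>n\<close> is the dimension and
  \<open>q\<close> the minimum of 1 and \<open>p\<close>. By \<open>p > \<delta> / n\<close> this
  decays in \<open>m\<close> as long as \<delta> < n, but at \<delta> = n the ratio is 1 and the
  series over the dilates diverges. There, however, \<open>p > 1\<close> holds and content of
  dimension \<open>n\<close> dominates Lebesgue measure, so truncating \<open>norm D\<close> at half
  the height, as in the Hardy-Littlewood maximal theorem, replaces the dilates. The condition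
  \<kappa> * p < \<delta> keeps the exponent of the content on the left positive.\<close>

lemma hcontent_le_countable_cover:
  fixes c :: "'i::countable \<Rightarrow> 'a::euclidean_space"
  assumes "\<And>i. 0 \<le> r i" "E \<subseteq> (\<Union>i. ball (c i) (r i))"
  shows "hcontent \<beta> E \<le> (\<integral>\<^sup>+i. ennreal (r i powr \<beta>) \<partial>count_space UNIV)"
proof -
  \<comment> \<open>Naturals outside the range of \<open>to_nat\<close> get radius 0: their balls
    are empty and cost nothing, because \<open>0 powr \<beta>\<close> is 0 for every
    \<beta>.\<close>
  define r' where "r' n = (if n \<in> range (to_nat :: 'i \<Rightarrow> nat) then r (from_nat n) else 0)" for n
  define c' where "c' n = c (from_nat n)" for n
  have "E \<subseteq> (\<Union>n. ball (c' n) (r' n))"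
  proof
    fix x assume "x \<in> E"
    then obtain i where "x \<in> ball (c i) (r i)" using assms(2) by blast
    then have "x \<in> ball (c' (to_nat i)) (r' (to_nat i))" by (simp add: r'_def c'_def)
    then show "x \<in> (\<Union>n. ball (c' n) (r' n))" by blast
  qed
  moreover have "\<forall>n. 0 \<le> r' n" using assms(1) by (auto simp: r'_def)
  ultimately have "hcontent \<beta> E \<le> (\<Sum>n. ennreal (r' n powr \<beta>))"
    unfolding hcontent_def by (intro Inf_lower) blast
  also have "\<dots> = (\<integral>\<^sup>+n. ennreal (r' n powr \<beta>) \<partial>count_space UNIV)"
    by (rule nn_integral_count_space_nat[symmetric])
  also have "\<dots> = (\<integral>\<^sup>+n. ennreal (r' n powr \<beta>) \<partial>count_space (range (to_nat :: 'i \<Rightarrow> nat)))"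
    by (rule nn_integral_count_space_eq) (auto simp: r'_def)
  also have "\<dots> = (\<integral>\<^sup>+i. ennreal (r' (to_nat (i::'i)) powr \<beta>) \<partial>count_space UNIV)"
    by (rule nn_integral_bij_count_space[symmetric]) (auto simp: bij_betw_def)
  also have "\<dots> = (\<integral>\<^sup>+i. ennreal (r i powr \<beta>) \<partial>count_space UNIV)"
    by (simp add: r'_def)
  finally show ?thesis .
qed

lemma hcontent_mono: "A \<subseteq> B \<Longrightarrow> hcontent \<beta> A \<le> hcontent \<beta> B"
  unfolding hcontent_def by (intro Inf_superset_mono) blast

text \<open>Strictness is the point: the integral is the supremum of its finite truncations by
  \<open>to_nat\<close>, so one of them already exceeds \<open>t\<close>. A finite family of cells
  has a last member in the order from coarse to fine, while an infinite one may have none.\<close>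

lemma less_nn_integral_count_spaceD:
  fixes v :: "'i::countable \<Rightarrow> ennreal"
  assumes "t < (\<integral>\<^sup>+j. v j * indicator A j \<partial>count_space UNIV)"
  shows "\<exists>J. finite J \<and> J \<subseteq> A \<and> t < sum v J"
proof -
  define B where "B N = A \<inter> {j. to_nat j < N}" for N
  have fin: "finite (B N)" for N
    unfolding B_def by (rule finite_Int, rule disjI2, rule finite_imageD[of to_nat])
      (auto intro: finite_subset[of _ "{..<N}"])
  have "(\<lambda>j. v j * indicator A j) = (\<lambda>j. SUP N. v j * indicator (B N) j)"
  proof
    fix j
    show "v j * indicator A j = (SUP N. v j * indicator (B N) j)"
    proof (rule antisym)
      have "v j * indicator A j \<le> v j * indicator (B (Suc (to_nat j))) j"
        by (auto simp: B_def split: split_indicator)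
      then show "v j * indicator A j \<le> (SUP N. v j * indicator (B N) j)"
        by (rule SUP_upper2[rotated]) auto
      show "(SUP N. v j * indicator (B N) j) \<le> v j * indicator A j"
        by (intro SUP_least) (auto simp: B_def split: split_indicator)
    qed
  qed
  then have "(\<integral>\<^sup>+j. v j * indicator A j \<partial>count_space UNIV)
      = (\<integral>\<^sup>+j. (SUP N. v j * indicator (B N) j) \<partial>count_space UNIV)" by simp
  also have "\<dots> = (SUP N. \<integral>\<^sup>+j. v j * indicator (B N) j \<partial>count_space UNIV)"
    by (rule nn_integral_monotone_convergence_SUP)
      (auto simp: incseq_def le_fun_def B_def split: split_indicator)
  finally obtain N where "t < (\<integral>\<^sup>+j. v j * indicator (B N) j \<partial>count_space UNIV)"
    using assms by (auto simp: less_SUP_iff)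
  also have "\<dots> = sum v (B N)"
    using fin[of N] by (subst nn_integral_count_space'[where A="B N"]) (auto intro!: sum.cong)
  finally show ?thesis using fin[of N] by (auto simp: B_def)
qed

text \<open>A half-open dyadic cube of side \<open>2 powr - k\<close>, addressed by any point
  \<open>z\<close> of it instead of a lattice index. At a fixed scale membership is an equivalence
  relation, so two cells of the same scale coincide or are disjoint.\<close>

definition dyadic_cell :: "int \<Rightarrow> 'a::euclidean_space \<Rightarrow> 'a set" where
  "dyadic_cell k z = {y. \<forall>i\<in>Basis. \<lfloor>2 powr k * (y \<bullet> i)\<rfloor> = \<lfloor>2 powr k * (z \<bullet> i)\<rfloor>}"

text \<open>The coarse floor of a coordinate is the integer quotient of the fine floor by
  \<open>2 ^ N\<close>, so agreement at scale \<open>m\<close> forces agreement at scale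
  \<open>k\<close>. This is the nesting of dyadic cells.\<close>

lemma mem_dyadic_cell_coarser:
  assumes "k \<le> m" "y \<in> dyadic_cell m z"
  shows "y \<in> dyadic_cell k z"
proof -
  define N where "N = nat (m - k)"
  have eq: "\<lfloor>2 powr k * a\<rfloor> = \<lfloor>2 powr m * a\<rfloor> div 2 ^ N" for a
  proof -
    have "2 powr k * a = 2 powr m * a / real_of_int (2 ^ N)"
      using assms(1) by (simp add: N_def powr_realpow[symmetric] powr_diff)
    then show ?thesis by (simp only: floor_divide_real_eq_div zero_le_power zero_le_numeral)
  qed
  show ?thesis using assms(2) unfolding dyadic_cell_def by (auto simp: eq)
qed

lemma dyadic_cell_subset_ball:
  fixes z :: "'a::euclidean_space"
  shows "dyadic_cell k z \<subseteq> ball z (real DIM('a) * 2 powr - real_of_int k)"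
proof
  fix y assume y: "y \<in> dyadic_cell k z"
  have "\<bar>(y - z) \<bullet> i\<bar> < 2 powr - real_of_int k" if "i \<in> Basis" for i
  proof -
    have "\<lfloor>2 powr k * (y \<bullet> i)\<rfloor> = \<lfloor>2 powr k * (z \<bullet> i)\<rfloor>"
      using y that by (simp add: dyadic_cell_def)
    then have "\<bar>2 powr k * (y \<bullet> i) - 2 powr k * (z \<bullet> i)\<bar> < 1" by linarith
    then have "2 powr k * \<bar>(y - z) \<bullet> i\<bar> < 1"
      by (simp add: inner_diff_left right_diff_distrib[symmetric] abs_mult)
    then show ?thesis by (simp add: powr_minus field_simps)
  qed
  \<comment> \<open>The l1 norm costs a factor \<open>DIM('a)\<close> in the radius, the origin of
    \<open>real DIM('a) powr \<beta>\<close> in the estimate for weighted cells.\<close>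
  then have "(\<Sum>i\<in>Basis. \<bar>(y - z) \<bullet> i\<bar>) < (\<Sum>i\<in>(Basis::'a set). 2 powr - real_of_int k)"
    by (intro sum_strict_mono) auto
  with norm_le_l1[of "y - z"] show "y \<in> ball z (real DIM('a) * 2 powr - real_of_int k)"
    by (simp add: dist_norm norm_minus_commute)
qed

text \<open>In each coordinate a point of the ball is less than one side length away from the
  centre, so the two floors differ by at most 1. Hence at most \<open>3 ^ DIM('a)\<close> cells
  cover the ball, whatever its centre and scale.\<close>

lemma ball_subset_dyadic_cells:
  fixes c :: "'a::euclidean_space"
  assumes "\<rho> \<le> 2 powr - real_of_int k" "y \<in> ball c \<rho>"
  shows "\<exists>e. (\<forall>i\<in>Basis. e \<bullet> i \<in> {-1, 0, 1}) \<and> y \<in> dyadic_cell k (c + 2 powr - real_of_int k *\<^sub>R e)"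
proof -
  define g where "g i = \<lfloor>2 powr k * (y \<bullet> i)\<rfloor> - \<lfloor>2 powr k * (c \<bullet> i)\<rfloor>" for i
  define e where "e = (\<Sum>i\<in>Basis. real_of_int (g i) *\<^sub>R (i::'a))"
  have e: "e \<bullet> i = real_of_int (g i)" if "i \<in> Basis" for i
    using that by (simp add: e_def)
  have "g i \<in> {-1, 0, 1}" if "i \<in> Basis" for i
  proof -
    have "\<bar>(y - c) \<bullet> i\<bar> < 2 powr - real_of_int k"
      using Basis_le_norm[OF that, of "y - c"] assms by (simp add: dist_norm norm_minus_commute)
    then have "2 powr k * \<bar>(y - c) \<bullet> i\<bar> < 1" by (simp add: powr_minus field_simps)
    then have "\<bar>2 powr k * (y \<bullet> i) - 2 powr k * (c \<bullet> i)\<bar> < 1"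
      by (simp add: inner_diff_left right_diff_distrib[symmetric] abs_mult)
    then have "\<bar>g i\<bar> < 2" unfolding g_def by linarith
    then show ?thesis by auto
  qed
  moreover have "y \<in> dyadic_cell k (c + 2 powr - real_of_int k *\<^sub>R e)"
    unfolding dyadic_cell_def
  proof (intro CollectI ballI)
    fix i :: 'a assume i: "i \<in> Basis"
    have "2 powr k * ((c + 2 powr - real_of_int k *\<^sub>R e) \<bullet> i) = 2 powr k * (c \<bullet> i) + real_of_int (g i)"
      using i by (simp add: inner_add_left e distrib_left powr_minus)
    then show "\<lfloor>2 powr k * (y \<bullet> i)\<rfloor> = \<lfloor>2 powr k * ((c + 2 powr - real_of_int k *\<^sub>R e) \<bullet> i)\<rfloor>"
      by (simp add: g_def)
  qed
  ultimately show ?thesis using e by (intro exI[of _ e]) force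
qed

lemma finite_sign_vectors: "finite {e::'a::euclidean_space. \<forall>i\<in>Basis. e \<bullet> i \<in> {-1, 0, 1}}"
proof (rule finite_subset)
  show "{e::'a. \<forall>i\<in>Basis. e \<bullet> i \<in> {-1, 0, 1}}
      \<subseteq> (\<lambda>h. \<Sum>i\<in>Basis. h i *\<^sub>R i) ` (PiE Basis (\<lambda>_. {-1, 0, 1}))"
  proof
    fix e :: 'a assume e: "e \<in> {e. \<forall>i\<in>Basis. e \<bullet> i \<in> {-1, 0, 1}}"
    have "e = (\<Sum>i\<in>Basis. restrict (\<lambda>i. e \<bullet> i) Basis i *\<^sub>R i)"
      by (simp add: euclidean_representation)
    moreover have "restrict (\<lambda>i. e \<bullet> i) Basis \<in> PiE Basis (\<lambda>_. {-1, 0, 1})"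
      using e by (auto simp: restrict_PiE_iff)
    ultimately show "e \<in> (\<lambda>h. \<Sum>i\<in>Basis. h i *\<^sub>R i) ` (PiE Basis (\<lambda>_. {-1, 0, 1}))" by blast
  qed
  show "finite ((\<lambda>h. \<Sum>i\<in>Basis. h i *\<^sub>R (i::'a)) ` (PiE Basis (\<lambda>_. {-1, 0, 1})))"
    by (intro finite_imageI finite_PiE) auto
qed

text \<open>Countable subadditivity of the Choquet integral, on indicators of dyadic cells. Process the cells
  from coarse to fine and give cell \<open>i\<close> the interval \<open>[W i, W i + w i)\<close>, where \<open>W i\<close> is the total weight of
  the earlier cells containing it. Cells are nested or disjoint, so for every point \<open>x\<close> the intervals of
  the cells containing \<open>x\<close> tile \<open>(0, F x)\<close>, where \<open>F\<close> is the weighted sum: the cells whose interval contains \<open>t\<close> cover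
  \<open>{F > t}\<close>.\<close>

lemma hcontent_weighted_dyadic_cells:
  fixes k :: "'i::countable \<Rightarrow> int" and z :: "'i \<Rightarrow> 'a::euclidean_space" and w :: "'i \<Rightarrow> real"
  assumes \<beta>: "0 < \<beta>" and w: "\<And>i. 0 \<le> w i"
  shows "(\<integral>\<^sup>+t. indicator {0<..} t * hcontent \<beta> {x. ennreal t <
            (\<integral>\<^sup>+i. ennreal (w i) * indicator (dyadic_cell (k i) (z i)) x \<partial>count_space UNIV)} \<partial>lborel)
    \<le> ennreal (real DIM('a) powr \<beta>) *
        (\<integral>\<^sup>+i. ennreal (w i * (2 powr - real_of_int (k i)) powr \<beta>) \<partial>count_space UNIV)"
    (is "?L \<le> ennreal (?n powr \<beta>) * ?S")
proof (cases "?S = \<infinity>")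
  case True
  have "?n powr \<beta> > 0" by simp
  then show ?thesis unfolding True by (simp add: ennreal_mult_top)
next
  case False
  define l where "l i = 2 powr - real_of_int (k i)" for i
  have l: "l i > 0" for i by (simp add: l_def)
  define cell where "cell i = dyadic_cell (k i) (z i)" for i
  \<comment> \<open>Coarse to fine, with ties broken by \<open>to_nat\<close>: distinct indices are
    always comparable.\<close>
  define before where "before i j \<longleftrightarrow> k i < k j \<or> k i = k j \<and> to_nat i < to_nat j" for i j
  define Sr where "Sr = enn2real ?S"
  have S: "?S = ennreal Sr" and Sr: "Sr \<ge> 0" using False by (auto simp: Sr_def less_top[symmetric])
  \<comment> \<open>A cell with \<open>k j \<le> K\<close> has side at least
    \<open>2 powr - K\<close>, so \<open>w j\<close> is at most its share of the finite sum
    \<open>?S\<close> times \<open>(2 powr K) powr \<beta>\<close>. The bound makes every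
    \<open>W i\<close> finite and tends to 0 as \<open>K\<close> tends to minus infinity.\<close>
  have tail: "(\<integral>\<^sup>+j. ennreal (w j) * indicator {j. k j \<le> K} j \<partial>count_space UNIV)
      \<le> ennreal (Sr * (2 powr real_of_int K) powr \<beta>)" for K
  proof -
    have "(\<integral>\<^sup>+j. ennreal (w j) * indicator {j. k j \<le> K} j \<partial>count_space UNIV)
      \<le> (\<integral>\<^sup>+j. ennreal (w j * l j powr \<beta>) * ennreal ((2 powr real_of_int K) powr \<beta>) \<partial>count_space UNIV)"
    proof (rule nn_integral_mono)
      fix j
      have "w j \<le> w j * l j powr \<beta> * (2 powr real_of_int K) powr \<beta>" if "k j \<le> K"
      proof -
        have "1 \<le> (l j * 2 powr real_of_int K) powr \<beta>"
          using that \<beta> by (auto simp: l_def powr_add[symmetric] intro!: ge_one_powr_ge_zero)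
        then have "w j * 1 \<le> w j * (l j * 2 powr real_of_int K) powr \<beta>"
          by (intro mult_left_mono w) 
        then show ?thesis using l[of j] by (simp add: powr_mult mult.assoc)
      qed
      then show "ennreal (w j) * indicator {j. k j \<le> K} j
          \<le> ennreal (w j * l j powr \<beta>) * ennreal ((2 powr real_of_int K) powr \<beta>)"
        using w[of j] by (auto split: split_indicator simp: ennreal_mult[symmetric] intro!: ennreal_leI)
    qed
    also have "\<dots> = ?S * ennreal ((2 powr real_of_int K) powr \<beta>)"
      unfolding l_def by (rule nn_integral_multc) auto
    also have "\<dots> = ennreal (Sr * (2 powr real_of_int K) powr \<beta>)"
      unfolding S using Sr by (simp add: ennreal_mult)
    finally show ?thesis .
  qed
  define W where "W i = (\<integral>\<^sup>+j. ennreal (w j) * indicator {j. before j i \<and> z i \<in> cell j} j \<partial>count_space UNIV)" for i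
  have Wfin: "W i < \<infinity>" for i
  proof -
    have "W i \<le> (\<integral>\<^sup>+j. ennreal (w j) * indicator {j. k j \<le> k i} j \<partial>count_space UNIV)"
      unfolding W_def by (intro nn_integral_mono) (auto simp: before_def split: split_indicator)
    also have "\<dots> \<le> ennreal (Sr * (2 powr real_of_int (k i)) powr \<beta>)" by (rule tail)
    finally show ?thesis by (simp add: le_less_trans)
  qed
  define Wr where "Wr i = enn2real (W i)" for i
  have Wr: "W i = ennreal (Wr i)" "0 \<le> Wr i" for i using Wfin[of i] by (auto simp: Wr_def less_top)
  have key: "\<exists>i. x \<in> cell i \<and> t \<in> {Wr i ..< Wr i + w i}"
    if t: "0 < t" and F: "ennreal t < (\<integral>\<^sup>+i. ennreal (w i) * indicator (cell i) x \<partial>count_space UNIV)" for x t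
  proof -
    define V where "V i = (\<integral>\<^sup>+j. ennreal (w j) * indicator {j. before j i \<and> x \<in> cell j} j \<partial>count_space UNIV)" for i
    define P where "P i \<longleftrightarrow> x \<in> cell i \<and> ennreal t < V i + ennreal (w i)" for i
    \<comment> \<open>By nesting, an earlier cell contains \<open>x\<close> exactly when it contains
      the representative \<open>z i\<close>. The left end of the interval is thus the same for all
      points of cell \<open>i\<close>.\<close>
    have VW: "V i = W i" if "x \<in> cell i" for i
    proof -
      have "before j i \<and> x \<in> cell j \<longleftrightarrow> before j i \<and> z i \<in> cell j" for j
      proof -
        { assume "before j i"
          then have "k j \<le> k i" by (auto simp: before_def)
          then have "x \<in> dyadic_cell (k j) (z i)"
            using mem_dyadic_cell_coarser that unfolding cell_def by blast
          then have "x \<in> cell j \<longleftrightarrow> z i \<in> cell j" by (auto simp: cell_def dyadic_cell_def) }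
        then show ?thesis by blast
      qed
      then show ?thesis by (simp add: V_def W_def)
    qed
    \<comment> \<open>Take a finite subfamily of total weight above \<open>t\<close> and its last
      cell \<open>i\<close> in the order \<open>before\<close>. All other members precede
      \<open>i\<close> and contain \<open>x\<close>, so they are counted in \<open>V i\<close>, and
      \<open>V i + w i\<close> exceeds \<open>t\<close>.\<close>
    have step: "\<exists>i\<in>A. P i" if A: "A \<subseteq> {j. x \<in> cell j}"
      and tA: "ennreal t < (\<integral>\<^sup>+j. ennreal (w j) * indicator A j \<partial>count_space UNIV)" for A
    proof -
      obtain J where J: "finite J" "J \<subseteq> A" "ennreal t < sum (\<lambda>j. ennreal (w j)) J"
        using less_nn_integral_count_spaceD[OF tA] by blast
      then have "J \<noteq> {}" by auto
      then obtain i0 where i0: "i0 \<in> J" "k i0 = Max (k ` J)"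
        using J(1) by (metis obtains_MAX)
      define J1 where "J1 = {j\<in>J. k j = k i0}"
      have "finite J1" "J1 \<noteq> {}" using J(1) i0 by (auto simp: J1_def)
      then obtain i where i: "i \<in> J1" "to_nat i = Max (to_nat ` J1)"
        by (metis obtains_MAX)
      have bef: "before j i" if "j \<in> J" "j \<noteq> i" for j
      proof (cases "k j = k i0")
        case True
        then have "j \<in> J1" using that by (simp add: J1_def)
        then have "to_nat j \<le> to_nat i" using i \<open>finite J1\<close> by simp
        moreover have "to_nat j \<noteq> to_nat i" using that by simp
        ultimately show ?thesis using True i by (auto simp: before_def J1_def)
      next
        case False
        moreover have "k j \<le> k i0" using i0 J(1) that by simp
        ultimately show ?thesis using i by (auto simp: before_def J1_def)
      qed
      have iJ: "i \<in> J" using i by (simp add: J1_def)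
      have "sum (\<lambda>j. ennreal (w j)) (J - {i})
          = (\<integral>\<^sup>+j. ennreal (w j) * indicator (J - {i}) j \<partial>count_space UNIV)"
        using J(1) by (subst nn_integral_count_space'[where A="J - {i}"]) auto
      also have "\<dots> \<le> V i"
        unfolding V_def using bef J(2) A by (intro nn_integral_mono) (auto split: split_indicator)
      finally have le: "sum (\<lambda>j. ennreal (w j)) (J - {i}) \<le> V i" .
      have "ennreal t < ennreal (w i) + sum (\<lambda>j. ennreal (w j)) (J - {i})"
        using J(1,3) iJ by (simp add: sum.remove[of J i])
      also have "\<dots> \<le> ennreal (w i) + V i" by (intro add_left_mono le)
      finally have "ennreal t < V i + ennreal (w i)" by (simp add: add.commute)
      then show ?thesis using iJ J(2) A by (auto simp: P_def)
    qed
    \<comment> \<open>infinitely many coarser cells may contain \<open>x\<close>, but those beyond \<open>K\<close> have too little weight to matter, so a first cell exists\<close>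
    obtain K :: int where K: "Sr * (2 powr real_of_int K) powr \<beta> \<le> t"
    proof -
      define y where "y = log 2 (t / (Sr + 1)) / \<beta>"
      have "(2 powr real_of_int \<lfloor>y\<rfloor>) powr \<beta> \<le> (2 powr y) powr \<beta>"
        using \<beta> by (intro powr_mono2) auto
      also have "\<dots> = t / (Sr + 1)"
        using \<beta> t Sr by (simp add: powr_powr y_def)
      finally have "Sr * (2 powr real_of_int \<lfloor>y\<rfloor>) powr \<beta> \<le> Sr * (t / (Sr + 1))"
        by (intro mult_left_mono Sr)
      also have "\<dots> \<le> t" using Sr t by (simp add: field_simps)
      finally show ?thesis by (rule that)
    qed
    have PK: "K < k i" if "P i" for i
    proof (rule ccontr)
      assume "\<not> K < k i"
      have "V i + ennreal (w i) = V i + (\<integral>\<^sup>+j. ennreal (w j) * indicator {i} j \<partial>count_space UNIV)"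
        by (subst nn_integral_count_space'[where A="{i}"]) auto
      also have "\<dots> = (\<integral>\<^sup>+j. ennreal (w j) * indicator {j. before j i \<and> x \<in> cell j} j
           + ennreal (w j) * indicator {i} j \<partial>count_space UNIV)"
        unfolding V_def by (rule nn_integral_add[symmetric]) auto
      also have "\<dots> \<le> (\<integral>\<^sup>+j. ennreal (w j) * indicator {j. k j \<le> K} j \<partial>count_space UNIV)"
        using \<open>\<not> K < k i\<close> by (intro nn_integral_mono) (auto simp: before_def split: split_indicator)
      also have "\<dots> \<le> ennreal t"
        using tail[of K] K by (meson ennreal_leI order_trans)
      finally show False using that by (auto simp: P_def)
    qed
    have "indicator (cell i) x = (indicator {j. x \<in> cell j} i :: ennreal)" for i
      by (auto simp: indicator_def)
    then have "\<exists>i. P i" using step[of "{j. x \<in> cell j}"] F by auto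
    \<comment> \<open>A first index satisfying \<open>P\<close>: least scale, then least
      \<open>to_nat\<close>. By \<open>PK\<close> the differences \<open>k j - K\<close> are
      positive, so \<open>nat\<close> loses nothing.\<close>
    then obtain i1 where i1: "P i1" "\<And>j. P j \<Longrightarrow> nat (k i1 - K) \<le> nat (k j - K)"
      using ex_has_least_nat[of P _ "\<lambda>i. nat (k i - K)"] by blast
    then obtain i where i: "P i \<and> k i = k i1" "\<And>j. P j \<and> k j = k i1 \<Longrightarrow> to_nat i \<le> to_nat j"
      using ex_has_least_nat[of "\<lambda>i. P i \<and> k i = k i1" _ to_nat] by blast
    have nob: "\<not> before j i" if "P j" for j
      using i1(2)[OF that] PK[OF that] PK[OF i1(1)] i that by (force simp: before_def)
    have xi: "x \<in> cell i" using i by (simp add: P_def)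
    \<comment> \<open>Otherwise the cells before \<open>i\<close> would already have weight above
      \<open>t\<close>, and \<open>step\<close> would yield an earlier index satisfying
      \<open>P\<close>.\<close>
    have "\<not> ennreal t < V i"
      using step[of "{j. before j i \<and> x \<in> cell j}"] nob unfolding V_def by auto
    then have "W i \<le> ennreal t" by (simp add: VW[OF xi])
    then have "Wr i \<le> t" using t Wr[of i] by (simp add: ennreal_le_iff2)
    moreover have "ennreal t < ennreal (Wr i + w i)"
      using i(1) Wr[of i] w[of i] VW[OF xi] by (auto simp: P_def)
    then have "t < Wr i + w i" using t by (simp add: ennreal_less_iff)
    ultimately show ?thesis using xi by auto
  qed
  have "?L \<le> (\<integral>\<^sup>+t. (\<integral>\<^sup>+i. ennreal ((?n * l i) powr \<beta>) * indicator {Wr i ..< Wr i + w i} t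
      \<partial>count_space UNIV) \<partial>lborel)"
  proof (rule nn_integral_mono)
    fix t :: real
    define E where "E = {x. ennreal t < (\<integral>\<^sup>+i. ennreal (w i) * indicator (dyadic_cell (k i) (z i)) x \<partial>count_space UNIV)}"
    show "indicator {0<..} t * hcontent \<beta> E
      \<le> (\<integral>\<^sup>+i. ennreal ((?n * l i) powr \<beta>) * indicator {Wr i ..< Wr i + w i} t \<partial>count_space UNIV)"
    proof (cases "t > 0")
      case True
      define r where "r i = (if t \<in> {Wr i ..< Wr i + w i} then ?n * l i else 0)" for i
      have "E \<subseteq> (\<Union>i. ball (z i) (r i))"
      proof
        fix x assume "x \<in> E"
        then obtain i where i: "x \<in> cell i" "t \<in> {Wr i ..< Wr i + w i}"
          using key[OF True, of x] by (auto simp: E_def cell_def)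
        then have "x \<in> ball (z i) (r i)"
          using dyadic_cell_subset_ball[of "k i" "z i"] by (auto simp: r_def cell_def l_def)
        then show "x \<in> (\<Union>i. ball (z i) (r i))" by blast
      qed
      moreover have "0 \<le> r i" for i using l[of i] by (simp add: r_def)
      ultimately have "hcontent \<beta> E \<le> (\<integral>\<^sup>+i. ennreal (r i powr \<beta>) \<partial>count_space UNIV)"
        by (intro hcontent_le_countable_cover)
      also have "\<dots> = (\<integral>\<^sup>+i. ennreal ((?n * l i) powr \<beta>) * indicator {Wr i ..< Wr i + w i} t \<partial>count_space UNIV)"
        by (intro nn_integral_cong) (auto simp: r_def split: split_indicator)
      finally show ?thesis using True by simp
    qed simp
  qed
  \<comment> \<open>Tonelli: cell \<open>i\<close> is used only on an interval of length
    \<open>w i\<close>, which turns its cost into \<open>w i\<close> times a power of its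
    side.\<close>
  also have "\<dots> = (\<integral>\<^sup>+i. (\<integral>\<^sup>+t. ennreal ((?n * l i) powr \<beta>) * indicator {Wr i ..< Wr i + w i} t \<partial>lborel)
      \<partial>count_space UNIV)"
    by (rule nn_integral_count_space_nn_integral) auto
  also have "\<dots> = (\<integral>\<^sup>+i. ennreal (?n powr \<beta>) * ennreal (w i * l i powr \<beta>) \<partial>count_space UNIV)"
  proof (rule nn_integral_cong)
    fix i
    have "(\<integral>\<^sup>+t. ennreal ((?n * l i) powr \<beta>) * indicator {Wr i ..< Wr i + w i} t \<partial>lborel)
      = ennreal ((?n * l i) powr \<beta>) * ennreal (w i)"
      using w[of i] by (simp add: nn_integral_cmult_indicator)
    also have "\<dots> = ennreal (?n powr \<beta>) * ennreal (w i * l i powr \<beta>)"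
      using w[of i] l[of i] by (simp add: powr_mult ennreal_mult[symmetric] ac_simps)
    finally show "(\<integral>\<^sup>+t. ennreal ((?n * l i) powr \<beta>) * indicator {Wr i ..< Wr i + w i} t \<partial>lborel)
      = ennreal (?n powr \<beta>) * ennreal (w i * l i powr \<beta>)" .
  qed
  also have "\<dots> = ennreal (?n powr \<beta>) * ?S"
    unfolding l_def by (rule nn_integral_cmult) auto
  finally show ?thesis .
qed

text \<open>Each ball of positive radius is replaced by the cell of its centre and the neighbours of
  that cell, at the scale whose side lies between \<open>\<rho> i\<close> and
  \<open>2 * \<rho> i\<close>; each of them inherits the full weight. The weighted sum does not
  decrease pointwise, and the cost grows by a factor depending on \<beta> and the dimension
  only.\<close>

lemma hcontent_weighted_balls:
  assumes \<beta>: "0 < \<beta>"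
  shows "\<exists>C>0. \<forall>(c :: 'i::countable \<Rightarrow> 'a::euclidean_space) \<rho> w.
      (\<forall>i. 0 \<le> \<rho> i) \<and> (\<forall>i. 0 \<le> w i) \<longrightarrow>
      (\<integral>\<^sup>+t. indicator {0<..} t * hcontent \<beta> {x. ennreal t <
            (\<integral>\<^sup>+i. ennreal (w i) * indicator (ball (c i) (\<rho> i)) x \<partial>count_space UNIV)} \<partial>lborel)
      \<le> ennreal C * (\<integral>\<^sup>+i. ennreal (w i * \<rho> i powr \<beta>) \<partial>count_space UNIV)"
proof -
  define E where "E = {e::'a. \<forall>i\<in>Basis. e \<bullet> i \<in> {-1, 0, 1}}"
  define N where "N = card E"
  have "finite E" unfolding E_def by (rule finite_sign_vectors)
  then obtain e where e: "E = e ` {..<N}"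
    unfolding N_def by (metis ex_bij_betw_nat_finite bij_betw_imp_surj_on atLeast0LessThan)
  have "0 \<in> E" by (simp add: E_def)
  then have N: "N > 0" using \<open>finite E\<close> by (auto simp: N_def card_gt_0_iff)
  define C where "C = real DIM('a) powr \<beta> * (real N * 2 powr \<beta>)"
  have "C > 0" using N by (simp add: C_def)
  moreover have "(\<integral>\<^sup>+t. indicator {0<..} t * hcontent \<beta> {x. ennreal t <
            (\<integral>\<^sup>+i. ennreal (w i) * indicator (ball (c i) (\<rho> i)) x \<partial>count_space UNIV)} \<partial>lborel)
      \<le> ennreal C * (\<integral>\<^sup>+i. ennreal (w i * \<rho> i powr \<beta>) \<partial>count_space UNIV)"
    (is "?L \<le> _") if \<rho>: "\<And>i. 0 \<le> \<rho> i" and w: "\<And>i. 0 \<le> w i" for c :: "'i \<Rightarrow> 'a" and \<rho> w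
  proof -
    define k where "k i = \<lfloor>- log 2 (\<rho> i)\<rfloor>" for i
    have k: "\<rho> i \<le> 2 powr - real_of_int (k i)" "2 powr - real_of_int (k i) \<le> 2 * \<rho> i" if "0 < \<rho> i" for i
    proof -
      have "\<rho> i = 2 powr log 2 (\<rho> i)" using that by simp
      also have "\<dots> \<le> 2 powr - real_of_int (k i)"
        unfolding k_def by (intro powr_mono) linarith+
      finally show "\<rho> i \<le> 2 powr - real_of_int (k i)" .
      have "2 powr - real_of_int (k i) \<le> 2 powr (1 + log 2 (\<rho> i))"
        unfolding k_def by (intro powr_mono) linarith+
      also have "\<dots> = 2 * \<rho> i" using that by (simp add: powr_add)
      finally show "2 powr - real_of_int (k i) \<le> 2 * \<rho> i" .
    qed
    \<comment> \<open>The second index runs through all naturals so that the index type is a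
      countable product. Weight 0 switches off \<open>m \<ge> N\<close> as well as balls of radius
      0, for which \<open>log 2\<close> in \<open>k\<close> is only a default value.\<close>
    define w' where "w' = (\<lambda>(i, m). if m < N \<and> 0 < \<rho> i then w i else 0)"
    define k' where "k' = (\<lambda>(i, m::nat). k i)"
    define z' where "z' = (\<lambda>(i, m). c i + 2 powr - real_of_int (k i) *\<^sub>R e m)"
    have w': "0 \<le> w' im" for im using w by (auto simp: w'_def split: prod.split)
    have le: "(\<integral>\<^sup>+i. ennreal (w i) * indicator (ball (c i) (\<rho> i)) x \<partial>count_space UNIV)
      \<le> (\<integral>\<^sup>+im. ennreal (w' im) * indicator (dyadic_cell (k' im) (z' im)) x \<partial>count_space UNIV)" for x
    proof -
      have "ennreal (w i) * indicator (ball (c i) (\<rho> i)) x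
        \<le> (\<integral>\<^sup>+m. ennreal (w' (i, m)) * indicator (dyadic_cell (k' (i, m)) (z' (i, m))) x \<partial>count_space UNIV)" for i
      proof (cases "x \<in> ball (c i) (\<rho> i)")
        case True
        then have \<rho>i: "0 < \<rho> i" by (meson mem_ball zero_le_dist le_less_trans)
        obtain v where v: "v \<in> E" "x \<in> dyadic_cell (k i) (c i + 2 powr - real_of_int (k i) *\<^sub>R v)"
          using ball_subset_dyadic_cells[OF k(1)[OF \<rho>i] True] unfolding E_def by blast
        then obtain m where "m < N" "v = e m" using e by auto
        then have "ennreal (w i) * indicator (ball (c i) (\<rho> i)) x
          \<le> ennreal (w' (i, m)) * indicator (dyadic_cell (k' (i, m)) (z' (i, m))) x"
          using v \<rho>i by (simp add: w'_def k'_def z'_def indicator_def)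
        also have "\<dots> \<le> (\<integral>\<^sup>+m. ennreal (w' (i, m)) * indicator (dyadic_cell (k' (i, m)) (z' (i, m))) x \<partial>count_space UNIV)"
          by (rule nn_integral_ge_point) simp
        finally show ?thesis .
      qed simp
      then show ?thesis
        by (subst nn_integral_fst_count_space[symmetric]) (rule nn_integral_mono)
    qed
    have "?L \<le> (\<integral>\<^sup>+t. indicator {0<..} t * hcontent \<beta> {x. ennreal t <
            (\<integral>\<^sup>+im. ennreal (w' im) * indicator (dyadic_cell (k' im) (z' im)) x \<partial>count_space UNIV)} \<partial>lborel)"
      using le by (intro nn_integral_mono mult_left_mono hcontent_mono) (auto intro: less_le_trans)
    also have "\<dots> \<le> ennreal (real DIM('a) powr \<beta>) *
        (\<integral>\<^sup>+im. ennreal (w' im * (2 powr - real_of_int (k' im)) powr \<beta>) \<partial>count_space UNIV)"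
      by (rule hcontent_weighted_dyadic_cells[OF \<beta> w'])
    also have "(\<integral>\<^sup>+im. ennreal (w' im * (2 powr - real_of_int (k' im)) powr \<beta>) \<partial>count_space UNIV)
        = (\<integral>\<^sup>+i. (\<integral>\<^sup>+m. ennreal (w' (i, m) * (2 powr - real_of_int (k' (i, m))) powr \<beta>) \<partial>count_space UNIV) \<partial>count_space UNIV)"
      by (rule nn_integral_fst_count_space[symmetric])
    also have "\<dots> \<le> (\<integral>\<^sup>+i. ennreal (real N * 2 powr \<beta>) * ennreal (w i * \<rho> i powr \<beta>) \<partial>count_space UNIV)"
    proof (rule nn_integral_mono)
      fix i
      have "(\<integral>\<^sup>+m. ennreal (w' (i, m) * (2 powr - real_of_int (k' (i, m))) powr \<beta>) \<partial>count_space UNIV)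
          = (\<Sum>m<N. ennreal (w' (i, m) * (2 powr - real_of_int (k' (i, m))) powr \<beta>))"
        by (rule nn_integral_count_space') (auto simp: w'_def)
      also have "\<dots> \<le> (\<Sum>m<N. ennreal (2 powr \<beta> * (w i * \<rho> i powr \<beta>)))"
      proof (intro sum_mono ennreal_leI)
        fix m
        show "w' (i, m) * (2 powr - real_of_int (k' (i, m))) powr \<beta> \<le> 2 powr \<beta> * (w i * \<rho> i powr \<beta>)"
        proof (cases "m < N \<and> 0 < \<rho> i")
          case True
          then have "(2 powr - real_of_int (k i)) powr \<beta> \<le> (2 * \<rho> i) powr \<beta>"
            using k(2)[of i] \<beta> by (intro powr_mono2) auto
          then have "w i * (2 powr - real_of_int (k i)) powr \<beta> \<le> w i * (2 * \<rho> i) powr \<beta>"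
            by (intro mult_left_mono w)
          then show ?thesis using True by (simp add: w'_def k'_def powr_mult ac_simps)
        next
          case False
          then show ?thesis using w[of i] by (auto simp: w'_def)
        qed
      qed
      also have "\<dots> = ennreal (real N * 2 powr \<beta>) * ennreal (w i * \<rho> i powr \<beta>)"
        using w[of i] by (simp add: ennreal_of_nat_eq_real_of_nat ennreal_mult[symmetric] ac_simps)
      finally show "(\<integral>\<^sup>+m. ennreal (w' (i, m) * (2 powr - real_of_int (k' (i, m))) powr \<beta>) \<partial>count_space UNIV)
        \<le> ennreal (real N * 2 powr \<beta>) * ennreal (w i * \<rho> i powr \<beta>)" .
    qed
    also have "\<dots> = ennreal (real N * 2 powr \<beta>) * (\<integral>\<^sup>+i. ennreal (w i * \<rho> i powr \<beta>) \<partial>count_space UNIV)"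
      by (rule nn_integral_cmult) auto
    finally show ?thesis
      by (simp add: C_def ennreal_mult mult.assoc mult_left_mono)
  qed
  ultimately show ?thesis by blast
qed

section \<open>Fractional maximal function and the pointwise Hardy estimate\<close>

text \<open>Up to the factor \<open>unit_ball_vol DIM('a)\<close>, the supremum of
  \<open>r powr \<kappa>\<close> times the mean of \<open>f\<close> over
  \<open>ball x r\<close>.\<close>

definition frac_maximal :: "real \<Rightarrow> ('a::euclidean_space \<Rightarrow> real) \<Rightarrow> 'a \<Rightarrow> ennreal" where
  "frac_maximal \<kappa> f x = (SUP r\<in>{0<..}. (\<integral>\<^sup>+y. ennreal (f y) * indicator (ball x r) y \<partial>lborel)
      / ennreal (r powr (real DIM('a) - \<kappa>)))"

lemma frac_maximal_le_iff:
  fixes x :: "'a::euclidean_space"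
  shows "frac_maximal \<kappa> f x \<le> K \<longleftrightarrow>
    (\<forall>r>0. (\<integral>\<^sup>+y. ennreal (f y) * indicator (ball x r) y \<partial>lborel) \<le> K * ennreal (r powr (real DIM('a) - \<kappa>)))"
proof -
  have "a / ennreal c \<le> K \<longleftrightarrow> a \<le> K * ennreal c" if "c > 0" for a c
  proof
    assume "a / ennreal c \<le> K"
    then have "a / ennreal c * ennreal c \<le> K * ennreal c" by (rule mult_right_mono) simp
    then show "a \<le> K * ennreal c" using that by (simp add: ennreal_divide_times mult_divide_eq_ennreal)
  next
    assume "a \<le> K * ennreal c"
    then show "a / ennreal c \<le> K" using that by (intro divide_le_posI_ennreal) (auto simp: mult.commute)
  qed
  then show ?thesis unfolding frac_maximal_def by (auto simp: SUP_le_iff)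
qed

section \<open>Rescaling and integration along segments\<close>

lemma nn_integral_lborel_homothety:
  fixes x :: "'a::euclidean_space"
  assumes [measurable]: "g \<in> borel_measurable borel" and s: "0 < s"
  shows "(\<integral>\<^sup>+w. g w \<partial>lborel) = ennreal (s ^ DIM('a)) * (\<integral>\<^sup>+z. g (x + s *\<^sub>R (z - x)) \<partial>lborel)"
proof -
  have eq: "lborel = density (distr lborel borel (\<lambda>z. (x - s *\<^sub>R x) + s *\<^sub>R z)) (\<lambda>_. ennreal (\<bar>s\<bar> ^ DIM('a)))"
    using lborel_affine[of s "x - s *\<^sub>R x"] s by simp
  have "(\<integral>\<^sup>+w. g w \<partial>lborel) = (\<integral>\<^sup>+z. ennreal (s ^ DIM('a)) * g ((x - s *\<^sub>R x) + s *\<^sub>R z) \<partial>lborel)"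
    using s by (subst eq) (simp add: nn_integral_density nn_integral_distr)
  also have "\<dots> = ennreal (s ^ DIM('a)) * (\<integral>\<^sup>+z. g ((x - s *\<^sub>R x) + s *\<^sub>R z) \<partial>lborel)"
    by (rule nn_integral_cmult) simp
  finally show ?thesis by (simp add: algebra_simps)
qed

text \<open>The weight \<open>s powr - \<kappa>\<close> is what the fractional normalisation leaves
  after a ball has been shrunk by the factor \<open>s\<close>; \<kappa> < 1 makes it integrable at
  0.\<close>

lemma nn_integral_powr_unit_interval:
  assumes "0 \<le> \<kappa>" "\<kappa> < 1"
  shows "(\<integral>\<^sup>+s. indicator {0..1} s * ennreal (s powr - \<kappa>) \<partial>lborel) = ennreal (1 / (1 - \<kappa>))"
proof -
  have "((\<lambda>s. s powr - \<kappa>) has_integral (1 / (1 - \<kappa>))) {0..1}"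
    using has_integral_powr_from_0[of "- \<kappa>" 1] assms by simp
  then have "((\<lambda>s. if s \<in> {0..1} then s powr - \<kappa> else 0) has_integral (1 / (1 - \<kappa>))) UNIV"
    by (simp only: has_integral_restrict_UNIV)
  then have "(\<integral>\<^sup>+s. ennreal (if s \<in> {0..1} then s powr - \<kappa> else 0) \<partial>lborel) = ennreal (1 / (1 - \<kappa>))"
    by (intro nn_integral_has_integral_lborel) auto
  moreover have "ennreal (if s \<in> {0..1} then s powr - \<kappa> else 0) = indicator {0..1} s * ennreal (s powr - \<kappa>)" for s :: real
    by (auto split: split_indicator)
  ultimately show ?thesis by simp
qed

text \<open>Fundamental theorem of calculus on the segment from \<open>x\<close> to
  \<open>z\<close>, followed by Cauchy-Schwarz. The bound is a nonnegative integral in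
  \<open>s\<close> so that it can later be interchanged with integration in
  \<open>z\<close>.\<close>

lemma abs_diff_le_nn_integral_segment:
  fixes u :: "'a::euclidean_space \<Rightarrow> real"
  assumes grad: "\<And>x. GDERIV u x :> D x" and cont: "continuous_on UNIV D"
  shows "ennreal \<bar>u z - u x\<bar> \<le> ennreal (norm (z - x)) *
    (\<integral>\<^sup>+s. indicator {0..1} s * ennreal (norm (D (x + s *\<^sub>R (z - x)))) \<partial>lborel)"
proof -
  define g where "g s = x + s *\<^sub>R (z - x)" for s :: real
  have contg: "continuous_on S (\<lambda>s. D (g s))" for S
    unfolding g_def by (intro continuous_on_compose2[OF cont] continuous_intros) auto
  have "((\<lambda>s. D (g s) \<bullet> (z - x)) has_integral (u (g 1) - u (g 0))) {0..1}"
  proof (rule fundamental_theorem_of_calculus)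
    fix s :: real
    have "(u has_derivative (\<lambda>h. h \<bullet> D (g s))) (at (g s))"
      using grad[of "g s"] by (simp add: gderiv_def)
    moreover have "(g has_derivative (\<lambda>h. h *\<^sub>R (z - x))) (at s within {0..1})"
      unfolding g_def by (auto intro!: derivative_eq_intros)
    ultimately have "((\<lambda>s. u (g s)) has_derivative (\<lambda>h. (h *\<^sub>R (z - x)) \<bullet> D (g s))) (at s within {0..1})"
      by (rule has_derivative_compose[rotated])
    then show "((\<lambda>s. u (g s)) has_vector_derivative D (g s) \<bullet> (z - x)) (at s within {0..1})"
      by (simp add: has_vector_derivative_def inner_commute)
  qed simp
  then have eq: "u z - u x = integral {0..1} (\<lambda>s. D (g s) \<bullet> (z - x))"
    by (simp add: g_def integral_unique)
  define I where "I = integral {0..1} (\<lambda>s. norm (D (g s)))"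
  have I: "((\<lambda>s. norm (D (g s))) has_integral I) {0..1}"
    unfolding I_def by (intro integrable_integral integrable_continuous_real continuous_intros contg)
  have "norm (integral {0..1} (\<lambda>s. D (g s) \<bullet> (z - x))) \<le> integral {0..1} (\<lambda>s. norm (z - x) * norm (D (g s)))"
    by (intro integral_norm_bound_integral integrable_continuous_real continuous_intros contg)
      (simp add: Cauchy_Schwarz_ineq2 mult.commute)
  also have "\<dots> = norm (z - x) * I" by (simp add: I_def)
  finally have "\<bar>u z - u x\<bar> \<le> norm (z - x) * I" by (simp add: eq)
  moreover have "(\<integral>\<^sup>+s. indicator {0..1} s * ennreal (norm (D (g s))) \<partial>lborel) = ennreal I"
  proof -
    have [measurable]: "(\<lambda>s. norm (D (g s))) \<in> borel_measurable borel"
      by (intro borel_measurable_continuous_onI continuous_intros contg)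
    have "((\<lambda>s. if s \<in> {0..1} then norm (D (g s)) else 0) has_integral I) UNIV"
      using I by (simp only: has_integral_restrict_UNIV)
    then have "(\<integral>\<^sup>+s. ennreal (if s \<in> {0..1} then norm (D (g s)) else 0) \<partial>lborel) = ennreal I"
      by (intro nn_integral_has_integral_lborel) auto
    moreover have "ennreal (if s \<in> {0..1} then norm (D (g s)) else 0) = indicator {0..1} s * ennreal (norm (D (g s)))" for s
      by (auto split: split_indicator)
    ultimately show ?thesis by simp
  qed
  ultimately show ?thesis unfolding g_def by (simp add: ennreal_mult'[symmetric] ennreal_leI)
qed

text \<open>Integrating \<open>\<bar>u x\<bar> = \<bar>u x - u z\<bar>\<close> over the zeros \<open>z\<close> of \<open>u\<close> near the closest boundary point, with
  \<open>u x - u z\<close> written as an integral along the segment, avoids any Poincare inequality.\<close>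

lemma pointwise_hardy:
  fixes \<Omega> :: "'a::euclidean_space set"
  assumes \<Omega>: "open \<Omega>" "\<Omega> \<noteq> UNIV" "outer_regular \<Omega> b" and u: "C1_0_grad \<Omega> u D" and x: "x \<in> \<Omega>"
    and \<kappa>: "0 \<le> \<kappa>" "\<kappa> < 1" and K: "0 \<le> K" "frac_maximal \<kappa> (\<lambda>y. norm (D y)) x \<le> ennreal K"
  shows "infdist x (frontier \<Omega>) > 0"
    and "\<bar>u x\<bar> \<le> 2 powr (real DIM('a) + 1 - \<kappa>) / (b * (1 - \<kappa>) * unit_ball_vol DIM('a))
       * infdist x (frontier \<Omega>) powr (1 - \<kappa>) * K"
proof -
  define n where "n = DIM('a)"
  define \<omega> where "\<omega> = unit_ball_vol (real n)"
  have \<omega>: "\<omega> > 0" by (simp add: \<omega>_def)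
  have b: "b > 0" using \<Omega> by (simp add: outer_regular_def)
  have "frontier \<Omega> \<noteq> {}" using \<Omega> x by (auto simp: frontier_eq_empty)
  then obtain y where y: "y \<in> frontier \<Omega>" "infdist x (frontier \<Omega>) = dist x y"
    using infdist_attains_inf[of "frontier \<Omega>" x] by auto
  define d where "d = infdist x (frontier \<Omega>)"
  have "x \<notin> frontier \<Omega>" using x \<Omega> by (auto simp: frontier_def interior_open)
  then show d0: "infdist x (frontier \<Omega>) > 0" using y by auto
  then have d: "d > 0" by (simp add: d_def)
  have grad: "\<And>x. GDERIV u x :> D x" and cont: "continuous_on UNIV D"
    and supp: "closure {x. u x \<noteq> 0} \<subseteq> \<Omega>" using u by (auto simp: C1_0_grad_def)
  have [measurable]: "D \<in> borel_measurable borel" using cont by (rule borel_measurable_continuous_onI)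
  have [measurable]: "\<Omega> \<in> sets borel" using \<Omega> by simp
  have [measurable]: "ball x r \<in> sets borel" for r by simp
  \<comment> \<open>The part of \<open>ball y d\<close> outside \<Omega>: \<open>u\<close> vanishes
    on it, outer regularity at \<open>y\<close> gives it at least \<open>b\<close> times the volume
    of the ball, and it lies in \<open>ball x (2 * d)\<close> because
    \<open>dist x y = d\<close>.\<close>
  define E where "E = ball y d - \<Omega>"
  have E_sets[measurable]: "E \<in> sets borel" unfolding E_def by measurable
  have uE: "u z = 0" if "z \<in> E" for z
    using that supp closure_subset[of "{x. u x \<noteq> 0}"] by (auto simp: E_def)
  have Ed: "norm (z - x) < 2 * d" if "z \<in> E" for z
    using that dist_triangle[of z x y] y by (auto simp: E_def d_def dist_norm norm_minus_commute)
  have mE: "ennreal (b * (\<omega> * d ^ n)) \<le> emeasure lborel E"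
  proof -
    have "b * measure lebesgue (ball y d) \<le> measure lebesgue E"
      using \<Omega>(3) y d unfolding outer_regular_def E_def by blast
    moreover have "measure lebesgue (ball y d) = \<omega> * d ^ n"
      using content_ball[of d y] d by (simp add: \<omega>_def n_def)
    moreover have "measure lebesgue E = measure lborel E" by simp
    moreover have "emeasure lborel E < \<infinity>"
      unfolding E_def by (rule le_less_trans[OF emeasure_mono[of _ "ball y d"]])
        (use emeasure_bounded_finite[of "ball y d"] in auto)
    ultimately show ?thesis
      by (simp add: emeasure_eq_ennreal_measure ennreal_leI less_top)
  qed
  define f where "f w = ennreal (norm (D w))" for w
  have [measurable]: "f \<in> borel_measurable borel" unfolding f_def by measurable
  \<comment> \<open>The homothety with centre \<open>x\<close> and ratio \<open>s\<close> maps
    \<open>ball x (2 * d)\<close> onto \<open>ball x (2 * d * s)\<close> and contributes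
    \<open>s ^ n\<close>. The maximal function bounds the new integral by a multiple of
    \<open>s powr (n - \<kappa>)\<close>, which leaves \<open>s powr - \<kappa>\<close>.\<close>
  have inner: "(\<integral>\<^sup>+z. indicator (ball x (2 * d)) z * f (x + s *\<^sub>R (z - x)) \<partial>lborel)
      \<le> ennreal (K * (2 * d) powr (n - \<kappa>)) * ennreal (s powr - \<kappa>)" (is "?I \<le> _") if s: "0 < s" for s
  proof -
    have "ennreal (s ^ n) * ?I = ennreal (s ^ n) *
        (\<integral>\<^sup>+z. f (x + s *\<^sub>R (z - x)) * indicator (ball x (2 * d * s)) (x + s *\<^sub>R (z - x)) \<partial>lborel)"
    proof (rule arg_cong[OF nn_integral_cong])
      fix z
      have "x + s *\<^sub>R (z - x) \<in> ball x (2 * d * s) \<longleftrightarrow> z \<in> ball x (2 * d)"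
        using s by (simp add: dist_norm norm_minus_commute)
      then show "indicator (ball x (2 * d)) z * f (x + s *\<^sub>R (z - x))
        = f (x + s *\<^sub>R (z - x)) * indicator (ball x (2 * d * s)) (x + s *\<^sub>R (z - x))"
        by (simp add: indicator_def mult.commute)
    qed
    also have "\<dots> = (\<integral>\<^sup>+w. f w * indicator (ball x (2 * d * s)) w \<partial>lborel)"
      unfolding n_def by (rule nn_integral_lborel_homothety[symmetric, OF _ s]) measurable
    also have "\<dots> \<le> ennreal K * ennreal ((2 * d * s) powr (n - \<kappa>))"
      using K(2) s d unfolding frac_maximal_le_iff f_def n_def by simp
    also have "\<dots> = ennreal (s ^ n) * (ennreal (K * (2 * d) powr (n - \<kappa>)) * ennreal (s powr - \<kappa>))"
      using s d K(1) by (simp add: ennreal_mult[symmetric] powr_mult powr_diff powr_minus powr_realpow field_simps)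
    finally have le: "ennreal (s ^ n) * ?I
        \<le> ennreal (s ^ n) * (ennreal (K * (2 * d) powr (n - \<kappa>)) * ennreal (s powr - \<kappa>))" .
    have "0 < ennreal (s ^ n)" "ennreal (s ^ n) < top" using s by auto
    with le show ?thesis using ennreal_mult_le_mult_iff[of "ennreal (s ^ n)"] by fastforce
  qed
  have "ennreal \<bar>u x\<bar> * emeasure lborel E = (\<integral>\<^sup>+z. ennreal \<bar>u x\<bar> * indicator E z \<partial>lborel)"
    by (simp add: nn_integral_cmult_indicator)
  also have "\<dots> \<le> (\<integral>\<^sup>+z. (\<integral>\<^sup>+s. ennreal (2 * d) * (indicator {0..1} s *
        (indicator (ball x (2 * d)) z * f (x + s *\<^sub>R (z - x)))) \<partial>lborel) \<partial>lborel)"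
  proof (rule nn_integral_mono)
    fix z
    show "ennreal \<bar>u x\<bar> * indicator E z \<le> (\<integral>\<^sup>+s. ennreal (2 * d) * (indicator {0..1} s *
        (indicator (ball x (2 * d)) z * f (x + s *\<^sub>R (z - x)))) \<partial>lborel)"
    proof (cases "z \<in> E")
      case True
      have z: "z \<in> ball x (2 * d)" using Ed[OF True] by (simp add: dist_norm norm_minus_commute)
      have "ennreal \<bar>u x\<bar> = ennreal \<bar>u z - u x\<bar>" using uE[OF True] by simp
      also have "\<dots> \<le> ennreal (norm (z - x)) * (\<integral>\<^sup>+s. indicator {0..1} s * f (x + s *\<^sub>R (z - x)) \<partial>lborel)"
        unfolding f_def by (rule abs_diff_le_nn_integral_segment[OF grad cont])
      also have "\<dots> \<le> ennreal (2 * d) * (\<integral>\<^sup>+s. indicator {0..1} s * f (x + s *\<^sub>R (z - x)) \<partial>lborel)"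
        using Ed[OF True] by (intro mult_right_mono ennreal_leI) auto
      also have "\<dots> = (\<integral>\<^sup>+s. ennreal (2 * d) * (indicator {0..1} s * f (x + s *\<^sub>R (z - x))) \<partial>lborel)"
        by (rule nn_integral_cmult[symmetric]) measurable
      finally show ?thesis using z True by simp
    qed simp
  qed
  also have "\<dots> = (\<integral>\<^sup>+s. (\<integral>\<^sup>+z. ennreal (2 * d) * (indicator {0..1} s *
        (indicator (ball x (2 * d)) z * f (x + s *\<^sub>R (z - x)))) \<partial>lborel) \<partial>lborel)"
    by (rule lborel_pair.Fubini') measurable
  also have "\<dots> \<le> (\<integral>\<^sup>+s. ennreal (2 * d * (K * (2 * d) powr (n - \<kappa>))) * (indicator {0..1} s * ennreal (s powr - \<kappa>)) \<partial>lborel)"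
  proof (rule nn_integral_mono_AE)
    \<comment> \<open>The point \<open>s = 0\<close> has to be excluded: there
      \<open>s powr - \<kappa>\<close> is 0 by convention, while the left side need not
      vanish.\<close>
    show "AE s in lborel. (\<integral>\<^sup>+z. ennreal (2 * d) * (indicator {0..1} s *
        (indicator (ball x (2 * d)) z * f (x + s *\<^sub>R (z - x)))) \<partial>lborel)
      \<le> ennreal (2 * d * (K * (2 * d) powr (n - \<kappa>))) * (indicator {0..1} s * ennreal (s powr - \<kappa>))"
      using AE_lborel_singleton[of "0::real"]
    proof (rule AE_mp, intro AE_I2 impI)
      fix s :: real assume "s \<noteq> 0"
      show "(\<integral>\<^sup>+z. ennreal (2 * d) * (indicator {0..1} s *
          (indicator (ball x (2 * d)) z * f (x + s *\<^sub>R (z - x)))) \<partial>lborel)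
        \<le> ennreal (2 * d * (K * (2 * d) powr (n - \<kappa>))) * (indicator {0..1} s * ennreal (s powr - \<kappa>))"
      proof (cases "s \<in> {0..1}")
        case True
        then have s: "s > 0" using \<open>s \<noteq> 0\<close> by simp
        have "(\<integral>\<^sup>+z. ennreal (2 * d) * (indicator {0..1} s *
            (indicator (ball x (2 * d)) z * f (x + s *\<^sub>R (z - x)))) \<partial>lborel)
          = ennreal (2 * d) * (\<integral>\<^sup>+z. indicator (ball x (2 * d)) z * f (x + s *\<^sub>R (z - x)) \<partial>lborel)"
          using True by (simp add: nn_integral_cmult)
        also have "\<dots> \<le> ennreal (2 * d) * (ennreal (K * (2 * d) powr (n - \<kappa>)) * ennreal (s powr - \<kappa>))"
          by (intro mult_left_mono inner s) simp
        finally show ?thesis using True d K(1) by (simp add: ennreal_mult mult.assoc)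
      qed simp
    qed
  qed
  also have "\<dots> = ennreal (2 * d * (K * (2 * d) powr (n - \<kappa>))) * ennreal (1 / (1 - \<kappa>))"
    by (subst nn_integral_cmult) (simp_all add: nn_integral_powr_unit_interval[OF \<kappa>])
  also have "\<dots> = ennreal (2 * d * (K * (2 * d) powr (n - \<kappa>)) / (1 - \<kappa>))"
    using d K(1) \<kappa> by (simp add: ennreal_mult[symmetric])
  finally have "ennreal \<bar>u x\<bar> * ennreal (b * (\<omega> * d ^ n)) \<le> ennreal (2 * d * (K * (2 * d) powr (n - \<kappa>)) / (1 - \<kappa>))"
    using mE by (meson mult_left_mono order_trans zero_le)
  then have le: "\<bar>u x\<bar> * (b * (\<omega> * d ^ n)) \<le> 2 * d * (K * (2 * d) powr (n - \<kappa>)) / (1 - \<kappa>)"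
    using d K(1) \<kappa> b \<omega> by (simp add: ennreal_mult[symmetric])
  \<comment> \<open>Collecting powers: \<open>(2 * d) powr (n + 1 - \<kappa>)\<close> divided by the
    measure bound \<open>b * (\<omega> * d ^ n)\<close> leaves \<open>d powr (1 - \<kappa>)\<close>
    and the constant of the conclusion.\<close>
  have "2 * d * (K * (2 * d) powr (n - \<kappa>)) / (1 - \<kappa>)
      = (2 powr (real n + 1 - \<kappa>) / (b * (1 - \<kappa>) * \<omega>) * d powr (1 - \<kappa>) * K) * (b * (\<omega> * d ^ n))"
    using d \<kappa> b \<omega> by (simp add: powr_mult powr_diff powr_add powr_realpow[symmetric] field_simps)
  with le have "\<bar>u x\<bar> * (b * (\<omega> * d ^ n)) \<le>
      (2 powr (real n + 1 - \<kappa>) / (b * (1 - \<kappa>) * \<omega>) * d powr (1 - \<kappa>) * K) * (b * (\<omega> * d ^ n))" by simp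
  moreover have "b * (\<omega> * d ^ n) > 0" using b \<omega> d by simp
  ultimately have "\<bar>u x\<bar> \<le> 2 powr (real n + 1 - \<kappa>) / (b * (1 - \<kappa>) * \<omega>) * d powr (1 - \<kappa>) * K"
    by (simp only: mult_le_cancel_right_pos)
  then show "\<bar>u x\<bar> \<le> 2 powr (real DIM('a) + 1 - \<kappa>) / (b * (1 - \<kappa>) * unit_ball_vol DIM('a))
       * infdist x (frontier \<Omega>) powr (1 - \<kappa>) * K" unfolding d_def n_def \<omega>_def .
qed

section \<open>The maximal inequality below the top dimension\<close>

lemma ex_dyadic_level:
  assumes "0 < (a::real)"
  shows "\<exists>k::int. 2 powr k < a \<and> a \<le> 2 powr (k + 1)"
proof (intro exI conjI)
  have a: "a = 2 powr log 2 a" using assms by simp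
  have "2 powr (\<lceil>log 2 a\<rceil> - 1) < 2 powr log 2 a" by (intro powr_less_mono) linarith+
  then show "2 powr real_of_int (\<lceil>log 2 a\<rceil> - 1) < a" using a by simp
  have "2 powr log 2 a \<le> 2 powr (real_of_int (\<lceil>log 2 a\<rceil> - 1) + 1)" by (intro powr_mono) linarith+
  then show "a \<le> 2 powr (real_of_int (\<lceil>log 2 a\<rceil> - 1) + 1)" using a by simp
qed

lemma ex_dyadic_level_nat:
  assumes "1 \<le> (a::real)"
  shows "\<exists>m::nat. 2 ^ m \<le> a \<and> a < 2 ^ Suc m"
proof (intro exI conjI)
  define m where "m = nat \<lfloor>log 2 a\<rfloor>"
  have m: "real m = \<lfloor>log 2 a\<rfloor>" using assms by (simp add: m_def)
  have a: "a = 2 powr log 2 a" using assms by simp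
  have "2 ^ m = 2 powr real m" by (simp add: powr_realpow)
  also have "\<dots> \<le> 2 powr log 2 a" unfolding m by (intro powr_mono) auto
  finally show "2 ^ m \<le> a" using a by simp
  have "2 powr log 2 a < 2 powr real (Suc m)" using m by (intro powr_less_mono) linarith+
  also have "\<dots> = 2 ^ Suc m" by (simp only: powr_realpow zero_less_numeral)
  finally show "a < 2 ^ Suc m" using a by simp
qed

text \<open>The intervals \<open>J k\<close> are disjoint and have length
  \<open>(1 - 2 powr - p) * 2 powr (k * p)\<close>; for \<open>t\<close> in \<open>J k\<close> the
  set \<open>{x. 2 powr k < f x}\<close> lies in \<open>{x. t < f x powr p}\<close>. Monotonicity of
  content does the rest.\<close>

lemma sum_hcontent_levels_le_choquet_int:
  fixes f :: "'a::euclidean_space \<Rightarrow> real"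
  assumes p: "0 < p" and f: "\<And>x. 0 \<le> f x"
  shows "ennreal (1 - 2 powr - p) *
      (\<integral>\<^sup>+k. ennreal (2 powr (real_of_int k * p)) * hcontent \<delta> {x. 2 powr real_of_int k < f x} \<partial>count_space UNIV)
    \<le> choquet_int \<delta> UNIV (\<lambda>x. ennreal (f x powr p))"
proof -
  define H where "H k = hcontent \<delta> {x. 2 powr real_of_int k < f x}" for k
  define J where "J k = {2 powr (real_of_int (k - 1) * p) ..< 2 powr (real_of_int k * p)}" for k
  have "ennreal (1 - 2 powr - p) * (\<integral>\<^sup>+k. ennreal (2 powr (real_of_int k * p)) * H k \<partial>count_space UNIV)
      = (\<integral>\<^sup>+k. ennreal (1 - 2 powr - p) * (ennreal (2 powr (real_of_int k * p)) * H k) \<partial>count_space UNIV)"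
    by (rule nn_integral_cmult[symmetric]) auto
  also have "\<dots> = (\<integral>\<^sup>+k. (\<integral>\<^sup>+t. H k * indicator (J k) t \<partial>lborel) \<partial>count_space UNIV)"
  proof (rule nn_integral_cong)
    fix k :: int
    have eq: "2 powr (real_of_int (k - 1) * p) = 2 powr - p * 2 powr (real_of_int k * p)"
      by (simp add: powr_add[symmetric] algebra_simps)
    have "2 powr (real_of_int (k - 1) * p) \<le> 2 powr (real_of_int k * p)"
      using p by (intro powr_mono) auto
    then have "emeasure lborel (J k) = ennreal ((1 - 2 powr - p) * 2 powr (real_of_int k * p))"
      unfolding J_def eq by (simp add: left_diff_distrib)
    moreover have "2 powr - p \<le> 1" using p powr_mono[of "-p" 0 2] by simp
    ultimately show "ennreal (1 - 2 powr - p) * (ennreal (2 powr (real_of_int k * p)) * H k)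
        = (\<integral>\<^sup>+t. H k * indicator (J k) t \<partial>lborel)"
      by (simp add: nn_integral_cmult_indicator J_def ennreal_mult ac_simps)
  qed
  also have "\<dots> = (\<integral>\<^sup>+t. (\<integral>\<^sup>+k. H k * indicator (J k) t \<partial>count_space UNIV) \<partial>lborel)"
    by (rule nn_integral_count_space_nn_integral[symmetric]) (auto simp: J_def)
  also have "\<dots> \<le> (\<integral>\<^sup>+t. indicator {0<..} t * hcontent \<delta> {x\<in>UNIV. ennreal t < ennreal (f x powr p)} \<partial>lborel)"
  proof (rule nn_integral_mono)
    fix t :: real
    show "(\<integral>\<^sup>+k. H k * indicator (J k) t \<partial>count_space UNIV)
        \<le> indicator {0<..} t * hcontent \<delta> {x\<in>UNIV. ennreal t < ennreal (f x powr p)}"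
    proof (cases "\<exists>k. t \<in> J k")
      case True
      then obtain k where k: "t \<in> J k" by blast
      have uniq: "j = k" if "t \<in> J j" for j
      proof -
        have "2 powr (real_of_int (j - 1) * p) < 2 powr (real_of_int k * p)"
          "2 powr (real_of_int (k - 1) * p) < 2 powr (real_of_int j * p)"
          using k that unfolding J_def atLeastLessThan_iff by (meson le_less_trans)+
        then have "real_of_int (j - 1) < real_of_int k" "real_of_int (k - 1) < real_of_int j"
          using p by (simp_all only: powr_less_cancel_iff one_less_numeral_iff mult_less_cancel_right_pos semiring_norm)
        then show ?thesis by linarith
      qed
      have t: "t > 0" using k by (auto simp: J_def intro: less_le_trans[rotated])
      have "(\<integral>\<^sup>+j. H j * indicator (J j) t \<partial>count_space UNIV) = (\<Sum>j\<in>{k}. H j * indicator (J j) t)"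
        by (rule nn_integral_count_space') (auto dest: uniq simp: indicator_def)
      also have "\<dots> = H k" using k by simp
      also have "\<dots> \<le> hcontent \<delta> {x\<in>UNIV. ennreal t < ennreal (f x powr p)}"
        unfolding H_def
      proof (intro hcontent_mono subsetI CollectI conjI UNIV_I)
        fix x assume "x \<in> {x. 2 powr real_of_int k < f x}"
        then have "(2 powr real_of_int k) powr p < f x powr p" using p by (intro powr_less_mono2) auto
        then have "t < f x powr p" using k by (auto simp: J_def powr_powr)
        then show "ennreal t < ennreal (f x powr p)" using t by (simp add: ennreal_less_iff)
      qed
      finally show ?thesis using t by simp
    next
      case False
      then show ?thesis by simp
    qed
  qed
  finally show ?thesis unfolding choquet_int_def H_def .
qed

text \<open>Provides the weights that spread an arbitrarily small error over countably many
  coverings.\<close>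

lemma nn_integral_half_power_to_nat_le:
  "(\<integral>\<^sup>+k. ennreal ((1/2) ^ to_nat (k::'i::countable)) \<partial>count_space UNIV) \<le> 2"
proof -
  have "(\<integral>\<^sup>+k. ennreal ((1/2) ^ to_nat (k::'i)) \<partial>count_space UNIV)
      = (\<integral>\<^sup>+j. ennreal ((1/2) ^ j) \<partial>count_space (range (to_nat :: 'i \<Rightarrow> nat)))"
    by (rule nn_integral_bij_count_space) (auto simp: bij_betw_def)
  also have "\<dots> = (\<integral>\<^sup>+j. ennreal ((1/2) ^ j) * indicator (range (to_nat :: 'i \<Rightarrow> nat)) j \<partial>count_space UNIV)"
    by (simp add: nn_integral_count_space_indicator)
  also have "\<dots> \<le> (\<integral>\<^sup>+j. ennreal ((1/2) ^ j) \<partial>count_space UNIV)"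
    by (intro nn_integral_mono) (auto split: split_indicator)
  also have "\<dots> = ennreal (1 / (1 - 1/2))"
    unfolding nn_integral_count_space_nat by (intro suminf_ennreal_eq geometric_sums) auto
  finally show ?thesis by simp
qed

text \<open>If the balls meet, then \<open>x\<close> lies within \<open>2 * M\<close> of
  \<open>c\<close>, where \<open>M = max r \<rho>\<close>, and the one scale \<open>m\<close> with
  \<open>2 ^ m * \<rho>\<close> comparable to \<open>M\<close> already gives the bound. Summing over
  all \<open>m\<close> removes the choice of scale: \<open>r\<close> enters the right side only
  through \<open>r powr a\<close>, and the weighted balls are the same for every
  \<open>r\<close>.\<close>

lemma emeasure_balls_overlap_le:
  fixes x c :: "'a::euclidean_space"
  assumes a: "0 < a" "a \<le> real DIM('a)" and r: "0 < r" and \<rho>: "0 \<le> \<rho>"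
  shows "emeasure lborel (ball x r \<inter> ball c \<rho>) \<le> ennreal (unit_ball_vol DIM('a) * r powr a) *
    (\<integral>\<^sup>+m. ennreal (\<rho> powr DIM('a) * (2 ^ m * \<rho>) powr - a) * indicator (ball c (2 ^ (m + 2) * \<rho>)) x \<partial>count_space UNIV)"
proof (cases "\<rho> = 0 \<or> ball x r \<inter> ball c \<rho> = {}")
  case True
  then show ?thesis by auto
next
  case False
  define \<omega> where "\<omega> = unit_ball_vol (real DIM('a))"
  define n where "n = real DIM('a)"
  have \<omega>: "\<omega> > 0" by (simp add: \<omega>_def)
  have \<rho>0: "\<rho> > 0" using False \<rho> by simp
  obtain y where y: "dist x y < r" "dist c y < \<rho>" using False by auto
  define M where "M = max r \<rho>"
  obtain m where m: "2 ^ m \<le> M / \<rho>" "M / \<rho> < 2 ^ Suc m"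
    using ex_dyadic_level_nat[of "M / \<rho>"] \<rho>0 by (auto simp: M_def)
  have "dist c x < 2 * M" using y dist_triangle[of c x y] by (simp add: M_def dist_commute)
  also have "2 * M < 2 * (2 ^ Suc m * \<rho>)" using m(2) \<rho>0 by (simp add: field_simps)
  finally have xb: "x \<in> ball c (2 ^ (m + 2) * \<rho>)" by (simp add: field_simps)
  \<comment> \<open>For \<open>r \<le> \<rho>\<close> one keeps \<open>r powr a\<close> and enlarges
    the other factor, using \<open>a \<le> n\<close>; for \<open>r > \<rho>\<close> it is an
    equality with \<open>M = r\<close>.\<close>
  have min: "min r \<rho> powr n \<le> r powr a * \<rho> powr n * M powr - a"
  proof (cases "r \<le> \<rho>")
    case True
    have "r powr n = r powr a * r powr (n - a)" by (simp add: powr_add[symmetric])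
    also have "\<dots> \<le> r powr a * \<rho> powr (n - a)"
      using True r a by (intro mult_left_mono powr_mono2) (auto simp: n_def)
    finally show ?thesis using True \<rho>0 by (simp add: M_def powr_diff powr_minus field_simps max_def)
  next
    case False
    then show ?thesis using r by (simp add: M_def powr_minus field_simps)
  qed
  have "emeasure lborel (ball x r \<inter> ball c \<rho>) \<le> ennreal (\<omega> * min r \<rho> powr n)"
  proof (cases "r \<le> \<rho>")
    case True
    have "emeasure lborel (ball x r \<inter> ball c \<rho>) \<le> emeasure lborel (ball x r)"
      by (intro emeasure_mono) auto
    then show ?thesis using True r by (simp add: emeasure_ball \<omega>_def n_def powr_realpow)
  next
    case False
    have "emeasure lborel (ball x r \<inter> ball c \<rho>) \<le> emeasure lborel (ball c \<rho>)"
      by (intro emeasure_mono) auto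
    then show ?thesis using False \<rho>0 by (simp add: emeasure_ball \<omega>_def n_def powr_realpow)
  qed
  also have "\<dots> \<le> ennreal (\<omega> * (r powr a * \<rho> powr n * (2 ^ m * \<rho>) powr - a))"
  proof (intro ennreal_leI mult_left_mono)
    have "M powr - a \<le> (2 ^ m * \<rho>) powr - a"
      using a m(1) \<rho>0 by (intro powr_mono2') (auto simp: field_simps)
    then have "r powr a * \<rho> powr n * M powr - a \<le> r powr a * \<rho> powr n * (2 ^ m * \<rho>) powr - a"
      by (intro mult_left_mono) auto
    with min show "min r \<rho> powr n \<le> r powr a * \<rho> powr n * (2 ^ m * \<rho>) powr - a" by simp
  qed (use \<omega> in auto)
  also have "\<dots> = ennreal (\<omega> * r powr a) * (ennreal (\<rho> powr n * (2 ^ m * \<rho>) powr - a) * indicator (ball c (2 ^ (m + 2) * \<rho>)) x)"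
    using xb \<omega> by (simp add: ennreal_mult[symmetric] ac_simps)
  also have "\<dots> \<le> ennreal (\<omega> * r powr a) *
    (\<integral>\<^sup>+m. ennreal (\<rho> powr n * (2 ^ m * \<rho>) powr - a) * indicator (ball c (2 ^ (m + 2) * \<rho>)) x \<partial>count_space UNIV)"
    by (intro mult_left_mono nn_integral_ge_point) auto
  finally show ?thesis unfolding \<omega>_def n_def .
qed

text \<open>Covering balls weighted with their heights dominate \<open>f powr s\<close>. Integrating
  over \<open>ball x d\<close> and applying the overlap bound gives \<open>d powr a\<close> times a
  weighted sum of indicators of dilated balls at \<open>x\<close>, the same sum for every
  \<open>d\<close>. Since \<open>q \<le> 1\<close>, the \<open>q\<close>-th power of this sum is at
  most the sum of \<open>q\<close>-th powers, and the Choquet integral of the latter is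
  controlled.\<close>

lemma frac_maximal_hcontent_below_dim:
  fixes \<delta> \<kappa> p A :: real
  assumes \<delta>: "0 < \<delta>" "\<delta> < real DIM('a::euclidean_space)" and \<kappa>: "0 \<le> \<kappa>" "\<kappa> < 1"
    and p: "\<delta> / real DIM('a) < p" and \<kappa>p: "\<kappa> * p < \<delta>" and A: "0 < A"
  shows "\<exists>C>0. \<forall>f::'a \<Rightarrow> real. f \<in> borel_measurable borel \<and> (\<forall>x. 0 \<le> f x) \<longrightarrow>
     (\<integral>\<^sup>+t. indicator {0<..} t * hcontent (\<delta> - \<kappa> * p) {x. ennreal (A * t powr (1 / p)) < frac_maximal \<kappa> f x} \<partial>lborel)
     \<le> ennreal C * choquet_int \<delta> UNIV (\<lambda>x. ennreal (f x powr p))"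
proof -
  define n where "n = real DIM('a)"
  define \<omega> where "\<omega> = unit_ball_vol (real DIM('a))"
  have \<omega>: "\<omega> > 0" by (simp add: \<omega>_def)
  have n1: "1 \<le> n" unfolding n_def using DIM_positive[where 'a='a] by linarith
  have p0: "p > 0" using p \<delta> by (meson divide_pos_pos less_trans of_nat_0_less_iff DIM_positive)
  \<comment> \<open>Passing to \<open>f powr s\<close> turns the exponent \<open>p\<close> into \<open>q \<le> 1\<close>, for which powers are subadditive; \<open>\<delta> < n\<close> keeps \<open>\<delta> < n * q\<close>.\<close>
  define s where "s = max 1 p"
  define q where "q = p / s"
  have s: "1 \<le> s" by (simp add: s_def)
  have q: "0 < q" "q \<le> 1" "s * q = p" using p0 by (auto simp: q_def s_def max_def)
  have nq: "\<delta> < n * q"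
    using p \<delta> n1 by (auto simp: q_def s_def max_def n_def field_simps)
  \<comment> \<open>If the integral of \<open>f powr s\<close> over \<open>ball x d\<close> is of
    order \<open>d powr a\<close>, its mean is of order \<open>d powr (- \<kappa> * s)\<close>,
    which matches a mean of \<open>f\<close> of order \<open>d powr - \<kappa>\<close>. Positivity:
    \<kappa> * s is either \<kappa> < 1 or \<kappa> * p < \<delta> < n.\<close>
  define a where "a = n - \<kappa> * s"
  have "\<delta> < n" using \<delta> by (simp add: n_def)
  then have "\<kappa> * s < n" using \<kappa> \<kappa>p n1 by (auto simp: s_def max_def)
  then have a: "0 < a" "a \<le> n" using \<kappa> s by (auto simp: a_def)
  define \<beta> where "\<beta> = \<delta> - \<kappa> * p"
  have \<beta>: "0 < \<beta>" using \<kappa>p by (simp add: \<beta>_def)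
  \<comment> \<open>Ratio of the geometric series over the dilates: since
    \<open>a * q = n * q - \<kappa> * p\<close>, raising \<open>m\<close> by 1 multiplies
    \<open>coef powr q * R powr \<beta>\<close> by \<open>2 powr (\<beta> - a * q)\<close>, which is
    \<theta>.\<close>
  define \<theta> where "\<theta> = 2 powr (\<delta> - n * q)"
  have \<theta>: "0 < \<theta>" "\<theta> < 1" using nq powr_less_mono[of "\<delta> - n * q" 0 2] by (auto simp: \<theta>_def)
  \<comment> \<open>Chosen so that
    \<open>2 * \<omega> * (t / C') powr (1 / p) = A * t powr (1 / p)\<close>; the 2 comes from
    splitting \<open>f\<close> at the height \<mu> below.\<close>
  define C' where "C' = (2 * \<omega> / A) powr p"
  have C': "C' > 0" using \<omega> A by (simp add: C'_def)
  obtain C1 where C1: "C1 > 0" and balls: "\<And>(c :: (int \<times> nat) \<times> nat \<Rightarrow> 'a) \<rho> w.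
      (\<forall>i. 0 \<le> \<rho> i) \<and> (\<forall>i. 0 \<le> w i) \<Longrightarrow>
      (\<integral>\<^sup>+t. indicator {0<..} t * hcontent \<beta> {x. ennreal t <
            (\<integral>\<^sup>+i. ennreal (w i) * indicator (ball (c i) (\<rho> i)) x \<partial>count_space UNIV)} \<partial>lborel)
      \<le> ennreal C1 * (\<integral>\<^sup>+i. ennreal (w i * \<rho> i powr \<beta>) \<partial>count_space UNIV)"
    using hcontent_weighted_balls[OF \<beta>, where 'i="(int \<times> nat) \<times> nat" and 'a='a] by blast
  define B where "B = C1 * (C' * 2 powr p * 4 powr \<beta> * (1 / (1 - \<theta>)))"
  have B: "B > 0" using C1 C' \<theta> by (simp add: B_def)
  have p2: "1 - 2 powr - p > 0" using p0 powr_less_mono[of "-p" 0 2] by simp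
  define C where "C = B / (1 - 2 powr - p)"
  have C: "C > 0" using B p2 by (simp add: C_def)
  have "(\<integral>\<^sup>+t. indicator {0<..} t * hcontent (\<delta> - \<kappa> * p) {x. ennreal (A * t powr (1 / p)) < frac_maximal \<kappa> f x} \<partial>lborel)
     \<le> ennreal C * choquet_int \<delta> UNIV (\<lambda>x. ennreal (f x powr p))" (is "?L \<le> _")
    if f_meas[measurable]: "f \<in> borel_measurable borel" and f: "\<And>x. 0 \<le> f x" for f :: "'a \<Rightarrow> real"
  proof -
    define lev where "lev k = {x. 2 powr real_of_int k < f x}" for k
    define H where "H k = hcontent \<delta> (lev k)" for k
    define HS where "HS = (\<integral>\<^sup>+k. ennreal (2 powr (real_of_int k * p)) * H k \<partial>count_space UNIV)"
    have HS: "ennreal (1 - 2 powr - p) * HS \<le> choquet_int \<delta> UNIV (\<lambda>x. ennreal (f x powr p))"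
      unfolding HS_def H_def lev_def by (rule sum_hcontent_levels_le_choquet_int[OF p0 f])
    have "?L \<le> ennreal B * HS"
    proof (cases "HS = \<infinity>")
      case True
      then show ?thesis using B by (simp add: ennreal_mult_top)
    next
      case False
      \<comment> \<open>Finiteness makes \<open>H k\<close> strictly smaller than
        \<open>H k + err k\<close>, which is what extracts a nearly optimal covering from the
        infimum.\<close>
      have Hfin: "H k < top" for k
      proof -
        have "ennreal (2 powr (real_of_int k * p)) * H k \<le> HS"
          unfolding HS_def by (rule nn_integral_ge_point) simp
        then have "ennreal (2 powr (real_of_int k * p)) * H k < top"
          using False by (metis infinity_ennreal_def le_less_trans less_top)
        then show ?thesis by (auto simp: ennreal_mult_less_top)
      qed
      show ?thesis
      proof (rule ennreal_le_epsilon)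
        fix e :: real assume e: "0 < e"
        define \<eta> where "\<eta> = e / (2 * B)"
        have \<eta>: "\<eta> > 0" using e B by (simp add: \<eta>_def)
        \<comment> \<open>The factor \<open>2 powr - (k * p)\<close> cancels the weight of level
          \<open>k\<close>; the weighted errors then add up to at most \<open>2 * \<eta>\<close>,
          and \<open>B * (2 * \<eta>) = e\<close>.\<close>
        define err where "err k = \<eta> * (1/2) ^ to_nat k * 2 powr - (real_of_int k * p)" for k :: int
        have err: "err k > 0" for k using \<eta> by (simp add: err_def)
        have "\<exists>c r. (\<forall>i. 0 \<le> r i) \<and> lev k \<subseteq> (\<Union>i. ball (c i) (r i))
            \<and> (\<Sum>i. ennreal (r i powr \<delta>)) < H k + ennreal (err k)" for k
        proof -
          have "H k < H k + ennreal (err k)"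
            using Hfin[of k] err[of k] by (simp add: ennreal_add_left_cancel_less[of "H k" 0, simplified])
          then show ?thesis unfolding H_def hcontent_def Inf_less_iff by blast
        qed
        then obtain c r where r: "\<And>k i. 0 \<le> r k i" and cov: "\<And>k. lev k \<subseteq> (\<Union>i. ball (c k i) (r k i))"
          and sum_r: "\<And>k. (\<Sum>i. ennreal (r k i powr \<delta>)) < H k + ennreal (err k)"
          by metis
        define \<rho> where "\<rho> = (\<lambda>(k, j). r k j)"
        define z where "z = (\<lambda>(k, j). c k j)"
        have \<rho>: "0 \<le> \<rho> kj" for kj using r by (simp add: \<rho>_def split: prod.split)
        \<comment> \<open>Upper bound for \<open>f powr s\<close> on the shell of level
          \<open>k\<close>, times the coefficient of the \<open>m\<close>-th dilate in the overlap
          bound. The index is \<open>((k, j), m)\<close>: level, covering ball, dilation.\<close>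
        define coef where "coef = (\<lambda>(kj, m). 2 powr (real_of_int (fst kj + 1) * s) * (\<rho> kj powr n * (2 ^ m * \<rho> kj) powr - a))"
        define R where "R = (\<lambda>(kj, m). 2 ^ (m + 2) * \<rho> kj)"
        define w where "w i = C' * coef i powr q" for i
        have coef: "0 \<le> coef i" for i by (simp add: coef_def split: prod.split)
        have R: "0 \<le> R i" for i using \<rho> by (simp add: R_def split: prod.split)
        have w: "0 \<le> w i" for i using C' by (simp add: w_def)
        define F where "F x = (\<integral>\<^sup>+i. ennreal (w i) * indicator (ball (z (fst i)) (R i)) x \<partial>count_space UNIV)" for x
        have key: "frac_maximal \<kappa> f x \<le> ennreal (A * t powr (1 / p))" if t: "0 < t" and Ft: "F x \<le> ennreal t" for x t
        proof -
          define T where "T = t / C'"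
          have T: "T > 0" using t C' by (simp add: T_def)
          have le_T: "(\<integral>\<^sup>+i. ennreal (coef i powr q) * indicator (ball (z (fst i)) (R i)) x \<partial>count_space UNIV) \<le> ennreal T"
          proof -
            have "ennreal C' * (\<integral>\<^sup>+i. ennreal (coef i powr q) * indicator (ball (z (fst i)) (R i)) x \<partial>count_space UNIV) = F x"
              unfolding F_def w_def using C'
              by (subst nn_integral_cmult[symmetric]) (auto simp: ennreal_mult mult.assoc intro!: nn_integral_cong)
            also have "\<dots> \<le> ennreal C' * ennreal T"
              using Ft C' T by (simp add: T_def ennreal_mult[symmetric])
            finally show ?thesis
              using C' ennreal_mult_le_mult_iff[of "ennreal C'"] by fastforce
          qed
          \<comment> \<open>Each term with \<open>x\<close> in its ball satisfies
            \<open>coef i powr q \<le> T\<close>, hence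
            \<open>coef i \<le> T powr (1 / q - 1) * coef i powr q\<close>. Summation gives the
            usual embedding of the sequence space of exponent \<open>q \<le> 1\<close> into that of
            exponent 1.\<close>
          have le_Tq: "(\<integral>\<^sup>+i. ennreal (coef i) * indicator (ball (z (fst i)) (R i)) x \<partial>count_space UNIV) \<le> ennreal (T powr (1 / q))"
          proof -
            have "(\<integral>\<^sup>+i. ennreal (coef i) * indicator (ball (z (fst i)) (R i)) x \<partial>count_space UNIV)
              \<le> (\<integral>\<^sup>+i. ennreal (T powr (1 / q - 1)) * (ennreal (coef i powr q) * indicator (ball (z (fst i)) (R i)) x) \<partial>count_space UNIV)"
            proof (rule nn_integral_mono)
              fix i
              show "ennreal (coef i) * indicator (ball (z (fst i)) (R i)) x
                \<le> ennreal (T powr (1 / q - 1)) * (ennreal (coef i powr q) * indicator (ball (z (fst i)) (R i)) x)"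
              proof (cases "x \<in> ball (z (fst i)) (R i)")
                case True
                have "ennreal (coef i powr q) * indicator (ball (z (fst i)) (R i)) x \<le> ennreal T"
                  by (rule order_trans[OF nn_integral_ge_point[OF UNIV_I] le_T])
                then have cT: "coef i powr q \<le> T" using True T by simp
                have "coef i = (coef i powr q) powr (1 / q - 1) * coef i powr q"
                  using q coef[of i] by (auto simp: powr_powr powr_add[symmetric] algebra_simps)
                also have "\<dots> \<le> T powr (1 / q - 1) * coef i powr q"
                  using cT q by (intro mult_right_mono powr_mono2) auto
                finally show ?thesis using True by (simp add: ennreal_mult[symmetric] ennreal_leI)
              qed simp
            qed
            also have "\<dots> = ennreal (T powr (1 / q - 1)) * (\<integral>\<^sup>+i. ennreal (coef i powr q) * indicator (ball (z (fst i)) (R i)) x \<partial>count_space UNIV)"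
              by (rule nn_integral_cmult) simp
            also have "\<dots> \<le> ennreal (T powr (1 / q - 1)) * ennreal T"
              by (intro mult_left_mono le_T) simp
            also have "\<dots> = ennreal (T powr (1 / q))"
              using T by (simp add: ennreal_mult[symmetric] powr_diff)
            finally show ?thesis .
          qed
          \<comment> \<open>Every \<open>y\<close> with \<open>f y > 0\<close> lies in a shell
            \<open>2 powr k < f y \<le> 2 powr (k + 1)\<close>, hence in a ball of the covering of
            \<open>lev k\<close>; where \<open>f y = 0\<close>, also
            \<open>f y powr s = 0\<close>.\<close>
          have pow_int: "(\<integral>\<^sup>+y. ennreal (f y powr s) * indicator (ball x d) y \<partial>lborel) \<le> ennreal (\<omega> * d powr a * T powr (1 / q))"
            if d: "0 < d" for d
          proof -
            have "(\<integral>\<^sup>+y. ennreal (f y powr s) * indicator (ball x d) y \<partial>lborel)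
              \<le> (\<integral>\<^sup>+y. (\<integral>\<^sup>+kj. ennreal (2 powr (real_of_int (fst kj + 1) * s)) * indicator (ball x d \<inter> ball (z kj) (\<rho> kj)) y \<partial>count_space UNIV) \<partial>lborel)"
            proof (rule nn_integral_mono)
              fix y
              show "ennreal (f y powr s) * indicator (ball x d) y
                \<le> (\<integral>\<^sup>+kj. ennreal (2 powr (real_of_int (fst kj + 1) * s)) * indicator (ball x d \<inter> ball (z kj) (\<rho> kj)) y \<partial>count_space UNIV)"
              proof (cases "y \<in> ball x d \<and> f y > 0")
                case True
                then obtain k where k: "2 powr real_of_int k < f y" "f y \<le> 2 powr (real_of_int k + 1)"
                  using ex_dyadic_level[of "f y"] by blast
                then have "y \<in> lev k" by (simp add: lev_def)
                then obtain j where j: "y \<in> ball (c k j) (r k j)" using cov[of k] by blast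
                have "f y powr s \<le> (2 powr (real_of_int k + 1)) powr s"
                  using k f[of y] s by (intro powr_mono2) auto
                also have "\<dots> = 2 powr (real_of_int (k + 1) * s)" by (simp add: powr_powr)
                finally have "ennreal (f y powr s) * indicator (ball x d) y
                    \<le> ennreal (2 powr (real_of_int (fst (k, j) + 1) * s)) * indicator (ball x d \<inter> ball (z (k, j)) (\<rho> (k, j))) y"
                  using True j by (simp add: z_def \<rho>_def ennreal_leI)
                also have "\<dots> \<le> (\<integral>\<^sup>+kj. ennreal (2 powr (real_of_int (fst kj + 1) * s)) * indicator (ball x d \<inter> ball (z kj) (\<rho> kj)) y \<partial>count_space UNIV)"
                  by (rule nn_integral_ge_point) simp
                finally show ?thesis .
              next
                case False
                then have "f y = 0 \<or> y \<notin> ball x d" using f[of y] by fastforce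
                then show ?thesis by auto
              qed
            qed
            also have "\<dots> = (\<integral>\<^sup>+kj. (\<integral>\<^sup>+y. ennreal (2 powr (real_of_int (fst kj + 1) * s)) * indicator (ball x d \<inter> ball (z kj) (\<rho> kj)) y \<partial>lborel) \<partial>count_space UNIV)"
              by (rule nn_integral_count_space_nn_integral[OF countableI_type],
                  intro borel_measurable_times_ennreal borel_measurable_const borel_measurable_indicator, simp)
            also have "\<dots> = (\<integral>\<^sup>+kj. ennreal (2 powr (real_of_int (fst kj + 1) * s)) * emeasure lborel (ball x d \<inter> ball (z kj) (\<rho> kj)) \<partial>count_space UNIV)"
              by (simp add: nn_integral_cmult_indicator)
            also have "\<dots> \<le> (\<integral>\<^sup>+kj. ennreal (\<omega> * d powr a) * (\<integral>\<^sup>+m. ennreal (coef (kj, m)) * indicator (ball (z (fst (kj, m))) (R (kj, m))) x \<partial>count_space UNIV) \<partial>count_space UNIV)"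
            proof (rule nn_integral_mono)
              fix kj :: "int \<times> nat"
              let ?c = "ennreal (2 powr (real_of_int (fst kj + 1) * s))"
              have "?c * emeasure lborel (ball x d \<inter> ball (z kj) (\<rho> kj))
                \<le> ?c * (ennreal (\<omega> * d powr a) * (\<integral>\<^sup>+m. ennreal (\<rho> kj powr n * (2 ^ m * \<rho> kj) powr - a) * indicator (ball (z kj) (2 ^ (m + 2) * \<rho> kj)) x \<partial>count_space UNIV))"
                unfolding \<omega>_def n_def using a d \<rho> by (intro mult_left_mono emeasure_balls_overlap_le) (auto simp: n_def)
              also have "\<dots> = ennreal (\<omega> * d powr a) * (\<integral>\<^sup>+m. ?c * (ennreal (\<rho> kj powr n * (2 ^ m * \<rho> kj) powr - a) * indicator (ball (z kj) (2 ^ (m + 2) * \<rho> kj)) x) \<partial>count_space UNIV)"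
                by (subst nn_integral_cmult) (auto simp: ac_simps)
              also have "\<dots> = ennreal (\<omega> * d powr a) * (\<integral>\<^sup>+m. ennreal (coef (kj, m)) * indicator (ball (z (fst (kj, m))) (R (kj, m))) x \<partial>count_space UNIV)"
                by (simp add: coef_def R_def ennreal_mult mult.assoc)
              finally show "?c * emeasure lborel (ball x d \<inter> ball (z kj) (\<rho> kj)) \<le> \<dots>" .
            qed
            also have "\<dots> = ennreal (\<omega> * d powr a) * (\<integral>\<^sup>+kj. (\<integral>\<^sup>+m. ennreal (coef (kj, m)) * indicator (ball (z (fst (kj, m))) (R (kj, m))) x \<partial>count_space UNIV) \<partial>count_space UNIV)"
              by (rule nn_integral_cmult) simp
            also have "\<dots> = ennreal (\<omega> * d powr a) * (\<integral>\<^sup>+i. ennreal (coef i) * indicator (ball (z (fst i)) (R i)) x \<partial>count_space UNIV)"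
              by (subst nn_integral_fst_count_space) simp
            also have "\<dots> \<le> ennreal (\<omega> * d powr a) * ennreal (T powr (1 / q))"
              by (intro mult_left_mono le_Tq) simp
            finally show ?thesis using \<omega> by (simp add: ennreal_mult)
          qed
          have "(\<integral>\<^sup>+y. ennreal (f y) * indicator (ball x d) y \<partial>lborel)
              \<le> ennreal (A * t powr (1 / p)) * ennreal (d powr (real DIM('a) - \<kappa>))" if d: "0 < d" for d
          proof -
            have [measurable]: "ball x d \<in> sets borel" by simp
            \<comment> \<open>The height that balances the splitting below: the bounds for both
              terms become \<open>\<omega> * T powr (1 / p) * d powr (n - \<kappa>)\<close>.\<close>
            define \<mu> where "\<mu> = T powr (1 / p) * d powr - \<kappa>"
            have \<mu>: "\<mu> > 0" using T d by (simp add: \<mu>_def)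
            \<comment> \<open>replaces Jensen, at the cost of the factor 2\<close>
            have fle: "f y \<le> \<mu> + \<mu> powr (1 - s) * f y powr s" for y
            proof (cases "f y \<le> \<mu>")
              case True
              then show ?thesis by (simp add: add_increasing2)
            next
              case False
              have "f y = f y powr (1 - s) * f y powr s"
                using False \<mu> by (simp add: powr_add[symmetric])
              also have "\<dots> \<le> \<mu> powr (1 - s) * f y powr s"
                using False \<mu> s by (intro mult_right_mono powr_mono2') auto
              finally show ?thesis using \<mu> by simp
            qed
            have "(\<integral>\<^sup>+y. ennreal (f y) * indicator (ball x d) y \<partial>lborel)
              \<le> (\<integral>\<^sup>+y. ennreal \<mu> * indicator (ball x d) y + ennreal (\<mu> powr (1 - s)) * (ennreal (f y powr s) * indicator (ball x d) y) \<partial>lborel)"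
            proof (rule nn_integral_mono)
              fix y
              have "ennreal (f y) \<le> ennreal (\<mu> + \<mu> powr (1 - s) * f y powr s)"
                by (rule ennreal_leI[OF fle])
              also have "\<dots> = ennreal \<mu> + ennreal (\<mu> powr (1 - s)) * ennreal (f y powr s)"
                using \<mu> by (simp add: ennreal_mult)
              finally show "ennreal (f y) * indicator (ball x d) y
                \<le> ennreal \<mu> * indicator (ball x d) y + ennreal (\<mu> powr (1 - s)) * (ennreal (f y powr s) * indicator (ball x d) y)"
                by (simp split: split_indicator)
            qed
            also have "\<dots> = ennreal \<mu> * emeasure lborel (ball x d) + ennreal (\<mu> powr (1 - s)) * (\<integral>\<^sup>+y. ennreal (f y powr s) * indicator (ball x d) y \<partial>lborel)"
              by (subst nn_integral_add, measurable) (simp add: nn_integral_cmult_indicator nn_integral_cmult)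
            also have "\<dots> \<le> ennreal \<mu> * ennreal (\<omega> * d powr n) + ennreal (\<mu> powr (1 - s)) * ennreal (\<omega> * d powr a * T powr (1 / q))"
              using d by (intro add_mono mult_left_mono pow_int) (auto simp: emeasure_ball \<omega>_def n_def powr_realpow)
            also have "\<dots> = ennreal (\<mu> * (\<omega> * d powr n) + \<mu> powr (1 - s) * (\<omega> * d powr a * T powr (1 / q)))"
              using \<mu> \<omega> by (simp add: ennreal_mult)
            also have "\<mu> * (\<omega> * d powr n) + \<mu> powr (1 - s) * (\<omega> * d powr a * T powr (1 / q)) = 2 * \<omega> * T powr (1 / p) * d powr (n - \<kappa>)"
            proof -
              have e1: "\<mu> * (\<omega> * d powr n) = \<omega> * T powr (1 / p) * d powr (n - \<kappa>)"
                using d by (simp add: \<mu>_def powr_diff powr_minus field_simps)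
              have "\<mu> powr (1 - s) = T powr (1 / p * (1 - s)) * d powr (- \<kappa> * (1 - s))"
                using T d by (simp add: \<mu>_def powr_mult powr_powr)
              then have e2: "\<mu> powr (1 - s) * (\<omega> * d powr a * T powr (1 / q))
                = \<omega> * (T powr (1 / p * (1 - s)) * T powr (1 / q)) * (d powr (- \<kappa> * (1 - s)) * d powr a)" by simp
              have e3: "T powr (1 / p * (1 - s)) * T powr (1 / q) = T powr (1 / p)"
              proof -
                have "1 / p * (1 - s) + 1 / q = 1 / p" using p0 s by (simp add: q_def field_simps)
                then show ?thesis by (simp add: powr_add[symmetric])
              qed
              have e4: "d powr (- \<kappa> * (1 - s)) * d powr a = d powr (n - \<kappa>)"
                by (simp add: powr_add[symmetric] a_def algebra_simps)
              show ?thesis unfolding e1 e2 e3 e4 by simp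
            qed
            also have "2 * \<omega> * T powr (1 / p) = A * t powr (1 / p)"
              using t C' \<omega> A p0 by (simp add: T_def powr_divide powr_mult C'_def powr_powr)
            finally show ?thesis using A by (simp add: ennreal_mult n_def)
          qed
          then show ?thesis unfolding frac_maximal_le_iff by blast
        qed
        have "?L \<le> (\<integral>\<^sup>+t. indicator {0<..} t * hcontent \<beta> {x. ennreal t < F x} \<partial>lborel)"
        proof (rule nn_integral_mono)
          fix t :: real
          show "indicator {0<..} t * hcontent (\<delta> - \<kappa> * p) {x. ennreal (A * t powr (1 / p)) < frac_maximal \<kappa> f x}
            \<le> indicator {0<..} t * hcontent \<beta> {x. ennreal t < F x}"
            using key[of t] unfolding \<beta>_def
            by (auto split: split_indicator intro!: hcontent_mono simp: not_le[symmetric])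
        qed
        also have "\<dots> \<le> ennreal C1 * (\<integral>\<^sup>+i. ennreal (w i * R i powr \<beta>) \<partial>count_space UNIV)"
          unfolding F_def by (rule balls) (use R w in blast)
        also have "(\<integral>\<^sup>+i. ennreal (w i * R i powr \<beta>) \<partial>count_space UNIV)
            = (\<integral>\<^sup>+kj. (\<integral>\<^sup>+m. ennreal (w (kj, m) * R (kj, m) powr \<beta>) \<partial>count_space UNIV) \<partial>count_space UNIV)"
          by (rule nn_integral_fst_count_space[symmetric])
        also have "\<dots> = (\<integral>\<^sup>+kj. ennreal (C' * 2 powr p * 4 powr \<beta> * (1 / (1 - \<theta>))) * (ennreal (2 powr (real_of_int (fst kj) * p)) * ennreal (\<rho> kj powr \<delta>)) \<partial>count_space UNIV)"
        proof (rule nn_integral_cong)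
          fix kj :: "int \<times> nat"
          \<comment> \<open>Cost of one dilate: the powers of \<open>\<rho> kj\<close> combine to
            \<open>\<rho> kj powr \<delta>\<close>, the cost of the covering ball itself, and those
            of \<open>2 ^ m\<close> to \<open>\<theta> ^ m\<close>.\<close>
          have "w (kj, m) * R (kj, m) powr \<beta> = C' * 2 powr p * 4 powr \<beta> * 2 powr (real_of_int (fst kj) * p) * \<rho> kj powr \<delta> * \<theta> ^ m" for m
          proof (cases "\<rho> kj = 0")
            case True
            then show ?thesis using \<delta> by (simp add: R_def)
          next
            case False
            then have \<rho>0: "\<rho> kj > 0" using \<rho>[of kj] by simp
            have aq: "a * q = n * q - \<kappa> * p" using q(3) by (simp add: a_def algebra_simps)
            have "coef (kj, m) powr q = 2 powr (real_of_int (fst kj + 1) * s * q) * (\<rho> kj powr (n * q) * (2 powr (m * (- a * q)) * \<rho> kj powr (- a * q)))"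
              using \<rho>0 by (simp add: coef_def powr_mult powr_powr powr_realpow[symmetric] mult.assoc)
            also have "real_of_int (fst kj + 1) * s * q = real_of_int (fst kj) * p + p"
              using q(3) by (simp add: algebra_simps)
            finally have 1: "coef (kj, m) powr q = 2 powr (real_of_int (fst kj) * p + p) * (\<rho> kj powr (n * q) * (2 powr (m * (- a * q)) * \<rho> kj powr (- a * q)))" .
            have "R (kj, m) = 4 * 2 powr m * \<rho> kj" by (simp add: R_def powr_realpow)
            then have 2: "R (kj, m) powr \<beta> = 4 powr \<beta> * 2 powr (m * \<beta>) * \<rho> kj powr \<beta>"
              using \<rho>0 by (simp add: powr_mult powr_powr)
            have 3: "\<rho> kj powr (n * q) * \<rho> kj powr (- a * q) * \<rho> kj powr \<beta> = \<rho> kj powr \<delta>"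
              by (simp add: powr_add[symmetric] aq \<beta>_def)
            have 4: "2 powr (m * (- a * q)) * 2 powr (m * \<beta>) = \<theta> ^ m"
              by (simp add: powr_add[symmetric] aq \<beta>_def \<theta>_def powr_power algebra_simps)
            have "w (kj, m) * R (kj, m) powr \<beta> = C' * 2 powr p * 4 powr \<beta> * 2 powr (real_of_int (fst kj) * p)
               * (\<rho> kj powr (n * q) * \<rho> kj powr (- a * q) * \<rho> kj powr \<beta>) * (2 powr (m * (- a * q)) * 2 powr (m * \<beta>))"
              unfolding w_def 1 2 by (simp add: powr_add)
            then show ?thesis unfolding 3 4 .
          qed
          then have "(\<integral>\<^sup>+m. ennreal (w (kj, m) * R (kj, m) powr \<beta>) \<partial>count_space UNIV)
              = (\<integral>\<^sup>+m. ennreal (C' * 2 powr p * 4 powr \<beta> * 2 powr (real_of_int (fst kj) * p) * \<rho> kj powr \<delta>) * ennreal (\<theta> ^ m) \<partial>count_space UNIV)"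
            using C' \<theta> by (simp add: ennreal_mult[symmetric])
          also have "\<dots> = ennreal (C' * 2 powr p * 4 powr \<beta> * 2 powr (real_of_int (fst kj) * p) * \<rho> kj powr \<delta>) * (\<integral>\<^sup>+m. ennreal (\<theta> ^ m) \<partial>count_space UNIV)"
            by (rule nn_integral_cmult) simp
          also have "(\<integral>\<^sup>+m. ennreal (\<theta> ^ m) \<partial>count_space UNIV) = ennreal (1 / (1 - \<theta>))"
            unfolding nn_integral_count_space_nat using \<theta> by (intro suminf_ennreal_eq geometric_sums) auto
          finally show "(\<integral>\<^sup>+m. ennreal (w (kj, m) * R (kj, m) powr \<beta>) \<partial>count_space UNIV)
              = ennreal (C' * 2 powr p * 4 powr \<beta> * (1 / (1 - \<theta>))) * (ennreal (2 powr (real_of_int (fst kj) * p)) * ennreal (\<rho> kj powr \<delta>))"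
            using C' \<theta> by (simp add: ennreal_mult[symmetric] ac_simps)
        qed
        also have "\<dots> = ennreal (C' * 2 powr p * 4 powr \<beta> * (1 / (1 - \<theta>))) * (\<integral>\<^sup>+kj. ennreal (2 powr (real_of_int (fst kj) * p)) * ennreal (\<rho> kj powr \<delta>) \<partial>count_space UNIV)"
          by (rule nn_integral_cmult) simp
        also have "ennreal C1 * \<dots> = ennreal B * (\<integral>\<^sup>+kj. ennreal (2 powr (real_of_int (fst kj) * p)) * ennreal (\<rho> kj powr \<delta>) \<partial>count_space UNIV)"
          unfolding B_def using C1 C' \<theta>
          by (subst ennreal_mult[of C1]) (simp_all add: mult.assoc)
        also have "(\<integral>\<^sup>+kj. ennreal (2 powr (real_of_int (fst kj) * p)) * ennreal (\<rho> kj powr \<delta>) \<partial>count_space UNIV)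
            = (\<integral>\<^sup>+k. (\<integral>\<^sup>+j. ennreal (2 powr (real_of_int k * p)) * ennreal (r k j powr \<delta>) \<partial>count_space UNIV) \<partial>count_space UNIV)"
          by (subst nn_integral_fst_count_space[symmetric]) (simp add: \<rho>_def)
        also have "\<dots> \<le> (\<integral>\<^sup>+k. ennreal (2 powr (real_of_int k * p)) * H k + ennreal \<eta> * ennreal ((1/2) ^ to_nat k) \<partial>count_space UNIV)"
        proof (rule nn_integral_mono)
          fix k :: int
          have "(\<integral>\<^sup>+j. ennreal (2 powr (real_of_int k * p)) * ennreal (r k j powr \<delta>) \<partial>count_space UNIV)
            = ennreal (2 powr (real_of_int k * p)) * (\<Sum>j. ennreal (r k j powr \<delta>))"
            by (subst nn_integral_cmult) (simp_all add: nn_integral_count_space_nat)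
          also have "\<dots> \<le> ennreal (2 powr (real_of_int k * p)) * (H k + ennreal (err k))"
            by (intro mult_left_mono less_imp_le[OF sum_r]) simp
          also have "\<dots> = ennreal (2 powr (real_of_int k * p)) * H k + ennreal \<eta> * ennreal ((1/2) ^ to_nat k)"
            using \<eta> by (simp add: distrib_left ennreal_mult[symmetric] err_def powr_minus field_simps)
          finally show "(\<integral>\<^sup>+j. ennreal (2 powr (real_of_int k * p)) * ennreal (r k j powr \<delta>) \<partial>count_space UNIV) \<le> \<dots>" .
        qed
        also have "\<dots> = HS + ennreal \<eta> * (\<integral>\<^sup>+k. ennreal ((1/2) ^ to_nat (k::int)) \<partial>count_space UNIV)"
          unfolding HS_def by (subst nn_integral_add) (auto simp: nn_integral_cmult)
        also have "\<dots> \<le> HS + ennreal \<eta> * 2"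
          by (intro add_left_mono mult_left_mono nn_integral_half_power_to_nat_le) simp
        finally have "?L \<le> ennreal B * (HS + ennreal \<eta> * 2)" by (simp add: mult_left_mono)
        also have "\<dots> = ennreal B * HS + ennreal B * (ennreal \<eta> * ennreal 2)"
          by (simp add: distrib_left)
        also have "ennreal B * (ennreal \<eta> * ennreal 2) = ennreal e"
          using B \<eta> by (simp only: ennreal_mult[symmetric] less_imp_le mult_nonneg_nonneg zero_le_numeral) (simp add: \<eta>_def)
        finally show "?L \<le> ennreal B * HS + ennreal e" .
      qed
    qed
    also have "ennreal B * HS = ennreal C * (ennreal (1 - 2 powr - p) * HS)"
      using B p2 p0 by (simp add: C_def mult.assoc[symmetric] ennreal_mult[symmetric])
    also have "\<dots> \<le> ennreal C * choquet_int \<delta> UNIV (\<lambda>x. ennreal (f x powr p))"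
      by (intro mult_left_mono HS) simp
    finally show ?thesis .
  qed
  then show ?thesis using C by blast
qed

section \<open>The maximal inequality in the top dimension\<close>

text \<open>Covering balls have total volume at least the measure of the set, and in dimension
  \<open>DIM('a)\<close> the cost of a ball is its volume up to
  \<open>unit_ball_vol\<close>.\<close>

lemma emeasure_le_hcontent:
  fixes S :: "'a::euclidean_space set"
  assumes "S \<in> sets borel"
  shows "emeasure lborel S \<le> ennreal (unit_ball_vol DIM('a)) * hcontent (real DIM('a)) S"
proof -
  define \<omega> where "\<omega> = unit_ball_vol (real DIM('a))"
  have \<omega>: "\<omega> > 0" by (simp add: \<omega>_def)
  have "ennreal (1 / \<omega>) * emeasure lborel S \<le> hcontent (real DIM('a)) S"
    unfolding hcontent_def
  proof (rule Inf_greatest, clarify)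
    fix c :: "nat \<Rightarrow> 'a" and r :: "nat \<Rightarrow> real"
    assume r: "\<forall>i. 0 \<le> r i" and cov: "S \<subseteq> (\<Union>i. ball (c i) (r i))"
    have "emeasure lborel S \<le> emeasure lborel (\<Union>i. ball (c i) (r i))"
      using cov by (intro emeasure_mono) auto
    also have "\<dots> \<le> (\<Sum>i. emeasure lborel (ball (c i) (r i)))"
      by (intro emeasure_subadditive_countably) auto
    also have "\<dots> = (\<Sum>i. ennreal \<omega> * ennreal (r i powr real DIM('a)))"
    proof (rule arg_cong[where f=suminf], rule ext)
      fix i
      have "r i ^ DIM('a) = r i powr real DIM('a)"
        using r[rule_format, of i] by (cases "r i = 0") (auto simp: powr_realpow)
      then show "emeasure lborel (ball (c i) (r i)) = ennreal \<omega> * ennreal (r i powr real DIM('a))"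
        using r \<omega> by (simp add: emeasure_ball \<omega>_def ennreal_mult[symmetric])
    qed
    also have "\<dots> = ennreal \<omega> * (\<Sum>i. ennreal (r i powr real DIM('a)))" by (rule ennreal_suminf_cmult)
    finally have "ennreal (1 / \<omega>) * emeasure lborel S \<le> ennreal (1 / \<omega>) * (ennreal \<omega> * (\<Sum>i. ennreal (r i powr real DIM('a))))"
      by (rule mult_left_mono) simp
    then show "ennreal (1 / \<omega>) * emeasure lborel S \<le> (\<Sum>i. ennreal (r i powr real DIM('a)))"
      using \<omega> by (simp add: mult.assoc[symmetric] ennreal_mult[symmetric])
  qed
  then have "ennreal \<omega> * (ennreal (1 / \<omega>) * emeasure lborel S) \<le> ennreal \<omega> * hcontent (real DIM('a)) S"
    by (rule mult_left_mono) simp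
  then show ?thesis
    using \<omega> unfolding \<omega>_def[symmetric] by (simp add: mult.assoc[symmetric] ennreal_mult[symmetric])
qed

lemma Vitali_covering_sequence:
  fixes K :: "('a::euclidean_space \<times> real) set"
  assumes K: "\<And>x s. (x, s) \<in> K \<Longrightarrow> 0 < s \<and> s \<le> B"
  obtains z r where "\<And>j::nat. 0 \<le> r j" "\<And>j. 0 < r j \<Longrightarrow> (z j, r j) \<in> K"
    "disjoint_family (\<lambda>j. if 0 < r j then cball (z j) (r j) else {})"
    "\<And>x s. (x, s) \<in> K \<Longrightarrow> \<exists>j. 0 < r j \<and> cball x s \<subseteq> ball (z j) (5 * r j)"
proof -
  obtain C where C: "countable C" "C \<subseteq> K"
     "pairwise (\<lambda>i j. disjnt (cball (fst i) (snd i)) (cball (fst j) (snd j))) C"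
     and cov: "\<And>i. i \<in> K \<Longrightarrow> \<exists>j. j \<in> C \<and> \<not> disjnt (cball (fst i) (snd i)) (cball (fst j) (snd j)) \<and>
                        cball (fst i) (snd i) \<subseteq> ball (fst j) (5 * snd j)"
    by (rule Vitali_covering_lemma_cballs_balls[of K snd B fst]) (use K in \<open>auto\<close>)
  define V where "V = to_nat_on C ` C"
  define g where "g j = from_nat_into C j" for j
  have g: "g (to_nat_on C i) = i" if "i \<in> C" for i
    using that C(1) by (simp add: g_def)
  define r where "r j = (if j \<in> V then snd (g j) else 0)" for j
  have gC: "g j \<in> C" if "j \<in> V" for j using that g by (auto simp: V_def)
  have Vr: "j \<in> V \<longleftrightarrow> 0 < r j" for j
    using gC[of j] C(2) K[of "fst (g j)" "snd (g j)"] by (auto simp: r_def)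
  show thesis
  proof (rule that[of r "\<lambda>j. fst (g j)"])
    show "0 \<le> r j" for j using Vr[of j] by (cases "j \<in> V") (auto simp: r_def)
    show "(fst (g j), r j) \<in> K" if "0 < r j" for j
    proof -
      have "j \<in> V" using that Vr by blast
      then show ?thesis using gC[of j] C(2) by (auto simp: r_def)
    qed
    show "disjoint_family (\<lambda>j. if 0 < r j then cball (fst (g j)) (r j) else {})"
      unfolding disjoint_family_on_def
    proof (intro ballI impI)
      fix i j :: nat assume ij: "i \<noteq> j"
      show "(if 0 < r i then cball (fst (g i)) (r i) else {}) \<inter> (if 0 < r j then cball (fst (g j)) (r j) else {}) = {}"
      proof (cases "i \<in> V \<and> j \<in> V")
        case True
        then have "g i \<noteq> g j" using ij g by (auto simp: V_def)
        then have "disjnt (cball (fst (g i)) (snd (g i))) (cball (fst (g j)) (snd (g j)))"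
          using C(3) gC True by (auto simp: pairwise_def)
        then show ?thesis using True by (auto simp: r_def disjnt_def)
      next
        case False
        then have "\<not> 0 < r i \<or> \<not> 0 < r j" using Vr by blast
        then show ?thesis by auto
      qed
    qed
    show "\<exists>j. 0 < r j \<and> cball x s \<subseteq> ball (fst (g j)) (5 * r j)" if xs: "(x, s) \<in> K" for x s
    proof -
      obtain i where i: "i \<in> C" "cball x s \<subseteq> ball (fst i) (5 * snd i)" using cov[OF xs] by auto
      then have V: "to_nat_on C i \<in> V" by (simp add: V_def)
      then have "r (to_nat_on C i) = snd i" using g[OF i(1)] by (simp add: r_def)
      moreover have "0 < r (to_nat_on C i)" using V Vr by blast
      ultimately show ?thesis using i g[OF i(1)] by (intro exI[of _ "to_nat_on C i"]) simp
    qed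
  qed
qed

section \<open>Geometric sums and truncation at dyadic heights\<close>

lemma nn_integral_int_geometric:
  fixes k :: int
  assumes "0 < \<epsilon>"
  shows "(\<integral>\<^sup>+m. ennreal (2 powr (real_of_int m * \<epsilon>)) * indicator {..k} m \<partial>count_space UNIV)
    = ennreal (2 powr (real_of_int k * \<epsilon>) / (1 - 2 powr - \<epsilon>))"
proof -
  have lt: "2 powr - \<epsilon> < (1::real)" using assms powr_less_mono[of "-\<epsilon>" 0 2] by simp
  have "(\<integral>\<^sup>+m. ennreal (2 powr (real_of_int m * \<epsilon>)) * indicator {..k} m \<partial>count_space UNIV)
    = (\<integral>\<^sup>+m. ennreal (2 powr (real_of_int m * \<epsilon>)) \<partial>count_space {..k})"
    by (simp add: nn_integral_count_space_indicator)
  also have "\<dots> = (\<integral>\<^sup>+i. ennreal (2 powr (real_of_int (k - int i) * \<epsilon>)) \<partial>count_space UNIV)"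
    by (rule nn_integral_bij_count_space[symmetric])
      (rule bij_betwI[where g="\<lambda>m. nat (k - m)"], auto)
  also have "\<dots> = (\<integral>\<^sup>+i. ennreal (2 powr (real_of_int k * \<epsilon>)) * ennreal ((2 powr - \<epsilon>) ^ i) \<partial>count_space UNIV)"
  proof (rule nn_integral_cong)
    fix i :: nat
    have "real_of_int (k - int i) * \<epsilon> = real_of_int k * \<epsilon> + - \<epsilon> * real i" by (simp add: algebra_simps)
    then have "2 powr (real_of_int (k - int i) * \<epsilon>) = 2 powr (real_of_int k * \<epsilon>) * 2 powr (- \<epsilon> * real i)"
      by (simp only: powr_add)
    also have "2 powr (- \<epsilon> * real i) = (2 powr - \<epsilon>) ^ i" by (subst powr_realpow[symmetric]) (simp_all add: powr_powr)
    finally show "ennreal (2 powr (real_of_int (k - int i) * \<epsilon>))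
        = ennreal (2 powr (real_of_int k * \<epsilon>)) * ennreal ((2 powr - \<epsilon>) ^ i)"
      by (simp add: ennreal_mult)
  qed
  also have "\<dots> = ennreal (2 powr (real_of_int k * \<epsilon>)) * (\<integral>\<^sup>+i. ennreal ((2 powr - \<epsilon>) ^ i) \<partial>count_space UNIV)"
    by (rule nn_integral_cmult) simp
  also have "(\<integral>\<^sup>+i. ennreal ((2 powr - \<epsilon>) ^ i) \<partial>count_space UNIV) = ennreal (1 / (1 - 2 powr - \<epsilon>))"
    unfolding nn_integral_count_space_nat using lt by (intro suminf_ennreal_eq geometric_sums) auto
  finally show ?thesis using lt by (simp add: ennreal_mult[symmetric])
qed

text \<open>A point of the shell \<open>2 powr k < f y \<le> 2 powr (k + 1)\<close> exceeds
  \<open>2 powr (m - 1)\<close> only if \<open>m \<le> k + 1\<close>. The shell is then enlarged to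
  the whole superlevel set, whose content occurs in the Choquet integral.\<close>

lemma nn_integral_above_level_le:
  fixes f :: "'a \<Rightarrow> real"
  assumes [measurable]: "f \<in> borel_measurable M"
  shows "(\<integral>\<^sup>+y. ennreal (f y) * indicator {y. 2 powr (real_of_int m - 1) < f y} y \<partial>M)
    \<le> (\<integral>\<^sup>+k. ennreal (2 powr (real_of_int k + 1)) * emeasure M {y\<in>space M. 2 powr real_of_int k < f y} * indicator {..k + 1} m \<partial>count_space UNIV)"
proof -
  have "(\<integral>\<^sup>+y. ennreal (f y) * indicator {y. 2 powr (real_of_int m - 1) < f y} y \<partial>M)
    \<le> (\<integral>\<^sup>+y. (\<integral>\<^sup>+k. ennreal (2 powr (real_of_int k + 1)) * indicator {..k + 1} m * indicator {y\<in>space M. 2 powr real_of_int k < f y} y \<partial>count_space UNIV) \<partial>M)"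
  proof (rule nn_integral_mono)
    fix y assume y: "y \<in> space M"
    show "ennreal (f y) * indicator {y. 2 powr (real_of_int m - 1) < f y} y
      \<le> (\<integral>\<^sup>+k. ennreal (2 powr (real_of_int k + 1)) * indicator {..k + 1} m * indicator {y\<in>space M. 2 powr real_of_int k < f y} y \<partial>count_space UNIV)"
    proof (cases "2 powr (real_of_int m - 1) < f y")
      case True
      then have "0 < f y" using powr_gt_zero[of 2 "real_of_int m - 1"] by linarith
      then obtain k where k: "2 powr real_of_int k < f y" "f y \<le> 2 powr (real_of_int k + 1)"
        using ex_dyadic_level by blast
      have "2 powr (real_of_int m - 1) < 2 powr (real_of_int k + 1)" using True k(2) by (rule less_le_trans)
      then have "real_of_int m - 1 < real_of_int k + 1" by simp
      then have "m \<le> k + 1" by linarith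
      then have "ennreal (f y) * indicator {y. 2 powr (real_of_int m - 1) < f y} y
        \<le> ennreal (2 powr (real_of_int k + 1)) * indicator {..k + 1} m * indicator {y\<in>space M. 2 powr real_of_int k < f y} y"
        using k y True by (simp add: ennreal_leI)
      also have "\<dots> \<le> (\<integral>\<^sup>+k. ennreal (2 powr (real_of_int k + 1)) * indicator {..k + 1} m * indicator {y\<in>space M. 2 powr real_of_int k < f y} y \<partial>count_space UNIV)"
        by (rule nn_integral_ge_point) simp
      finally show ?thesis .
    qed simp
  qed
  also have "\<dots> = (\<integral>\<^sup>+k. (\<integral>\<^sup>+y. ennreal (2 powr (real_of_int k + 1)) * indicator {..k + 1} m * indicator {y\<in>space M. 2 powr real_of_int k < f y} y \<partial>M) \<partial>count_space UNIV)"
    by (rule nn_integral_count_space_nn_integral[OF countableI_type]) measurable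
  also have "\<dots> = (\<integral>\<^sup>+k. ennreal (2 powr (real_of_int k + 1)) * emeasure M {y\<in>space M. 2 powr real_of_int k < f y} * indicator {..k + 1} m \<partial>count_space UNIV)"
    by (intro nn_integral_cong, subst nn_integral_cmult_indicator) (auto simp: ac_simps)
  finally show ?thesis .
qed

text \<open>Truncation at \<tau>: on a ball the values up to \<tau> contribute at most \<tau> times
  its volume, half of the assumed lower bound, so the other half comes from
  \<open>{y. \<tau> < f y}\<close>. Disjointness allows summation over the balls.\<close>

lemma sum_Vitali_balls_le:
  fixes f :: "'a::euclidean_space \<Rightarrow> real"
  assumes [measurable]: "f \<in> borel_measurable borel" and \<tau>: "0 \<le> \<tau>"
    and r: "\<And>j::nat. 0 \<le> r j"
    and dis: "disjoint_family (\<lambda>j. if 0 < r j then cball (z j) (r j) else {})"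
    and big: "\<And>j. 0 < r j \<Longrightarrow> ennreal (2 * \<tau> * (unit_ball_vol DIM('a) * r j ^ DIM('a)))
        < (\<integral>\<^sup>+y. ennreal (f y) * indicator (cball (z j) (r j)) y \<partial>lborel)"
  shows "(\<Sum>j. ennreal (\<tau> * (unit_ball_vol DIM('a) * r j ^ DIM('a))))
    \<le> (\<integral>\<^sup>+y. ennreal (f y) * indicator {y. \<tau> < f y} y \<partial>lborel)"
proof -
  define \<omega> where "\<omega> = unit_ball_vol (real DIM('a))"
  have \<omega>: "\<omega> > 0" by (simp add: \<omega>_def)
  define B where "B j = (if 0 < r j then cball (z j) (r j) else {})" for j
  have [measurable]: "B j \<in> sets borel" for j by (simp add: B_def)
  have each: "ennreal (\<tau> * (\<omega> * r j ^ DIM('a)))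
      \<le> (\<integral>\<^sup>+y. ennreal (f y) * indicator {y. \<tau> < f y} y * indicator (B j) y \<partial>lborel)" for j
  proof (cases "0 < r j")
    case True
    let ?X = "\<tau> * (\<omega> * r j ^ DIM('a))"
    have X: "0 \<le> ?X" using \<tau> \<omega> True by simp
    have Bj: "B j = cball (z j) (r j)" using True by (simp add: B_def)
    have "ennreal ?X + ennreal ?X = ennreal (2 * \<tau> * (\<omega> * r j ^ DIM('a)))"
      using X by (subst ennreal_plus[symmetric]) (auto simp: algebra_simps)
    also have "\<dots> \<le> (\<integral>\<^sup>+y. ennreal (f y) * indicator (B j) y \<partial>lborel)"
      unfolding Bj \<omega>_def by (rule less_imp_le[OF big[OF True]])
    also have "\<dots> \<le> (\<integral>\<^sup>+y. ennreal \<tau> * indicator (B j) y + ennreal (f y) * indicator {y. \<tau> < f y} y * indicator (B j) y \<partial>lborel)"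
      by (intro nn_integral_mono) (auto split: split_indicator intro: ennreal_leI)
    also have "\<dots> = ennreal \<tau> * emeasure lborel (B j) + (\<integral>\<^sup>+y. ennreal (f y) * indicator {y. \<tau> < f y} y * indicator (B j) y \<partial>lborel)"
      by (subst nn_integral_add, measurable) (simp add: nn_integral_cmult_indicator)
    also have "ennreal \<tau> * emeasure lborel (B j) = ennreal ?X"
      using True \<tau> \<omega> by (simp add: Bj emeasure_cball \<omega>_def ennreal_mult)
    finally show ?thesis by (simp add: ennreal_add_left_cancel_le)
  next
    case False
    then have "r j = 0" using r[of j] by simp
    then show ?thesis by (simp add: zero_power)
  qed
  have "(\<Sum>j. ennreal (\<tau> * (\<omega> * r j ^ DIM('a))))
      \<le> (\<Sum>j. \<integral>\<^sup>+y. ennreal (f y) * indicator {y. \<tau> < f y} y * indicator (B j) y \<partial>lborel)"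
    by (intro suminf_le each) auto
  also have "\<dots> = (\<integral>\<^sup>+y. (\<Sum>j. ennreal (f y) * indicator {y. \<tau> < f y} y * indicator (B j) y) \<partial>lborel)"
    by (rule nn_integral_suminf[symmetric]) measurable
  also have "\<dots> = (\<integral>\<^sup>+y. ennreal (f y) * indicator {y. \<tau> < f y} y * indicator (\<Union>j. B j) y \<partial>lborel)"
  proof (rule nn_integral_cong)
    fix y
    have "(\<Sum>j. indicator (B j) y :: ennreal) = indicator (\<Union>j. B j) y"
      by (rule suminf_indicator) (use dis in \<open>simp add: B_def[abs_def]\<close>)
    then show "(\<Sum>j. ennreal (f y) * indicator {y. \<tau> < f y} y * indicator (B j) y)
        = ennreal (f y) * indicator {y. \<tau> < f y} y * indicator (\<Union>j. B j) y"
      by (simp only: ennreal_suminf_cmult)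
  qed
  also have "\<dots> \<le> (\<integral>\<^sup>+y. ennreal (f y) * indicator {y. \<tau> < f y} y \<partial>lborel)"
    by (intro nn_integral_mono) (auto split: split_indicator)
  finally show ?thesis unfolding \<omega>_def .
qed

text \<open>At height \<open>2 powr m\<close> the Vitali balls have total volume at most a multiple
  of \<open>2 powr - m\<close> times the integral of \<open>f\<close> over
  \<open>{y. 2 powr (m - 1) < f y}\<close>. Weighting with \<open>2 powr (m * p)\<close> and
  exchanging sums leads to the levels of \<open>f\<close>, with a series in
  \<open>2 powr (m * (p - 1))\<close>. The finite integral of \<open>f\<close> bounds the radii at
  each height, as the covering lemma demands.\<close>

lemma frac_maximal_hcontent_dim:
  fixes \<kappa> p A :: real
  assumes \<kappa>: "0 \<le> \<kappa>" and p: "1 < p" and \<kappa>p: "\<kappa> * p < real DIM('a::euclidean_space)" and A: "0 < A"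
  shows "\<exists>C>0. \<forall>f::'a \<Rightarrow> real. f \<in> borel_measurable borel \<and> (\<forall>x. 0 \<le> f x) \<and> (\<integral>\<^sup>+x. ennreal (f x) \<partial>lborel) < \<infinity> \<longrightarrow>
     (\<integral>\<^sup>+t. indicator {0<..} t * hcontent (real DIM('a) - \<kappa> * p) {x. ennreal (A * t powr (1 / p)) < frac_maximal \<kappa> f x} \<partial>lborel)
     \<le> ennreal C * choquet_int (real DIM('a)) UNIV (\<lambda>x. ennreal (f x powr p))"
proof -
  define n where "n = real DIM('a)"
  define \<omega> where "\<omega> = unit_ball_vol (real DIM('a))"
  have \<omega>: "\<omega> > 0" by (simp add: \<omega>_def)
  have p0: "0 < p" using p by simp
  define \<beta> where "\<beta> = n - \<kappa> * p"
  have \<beta>: "0 < \<beta>" using \<kappa>p by (simp add: \<beta>_def n_def)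
  \<comment> \<open>Makes
    \<open>\<omega> * (t / C') powr (1 / p) = A * t powr (1 / p)\<close>.\<close>
  define C' where "C' = (\<omega> / A) powr p"
  have C': "C' > 0" using \<omega> A by (simp add: C'_def)
  obtain C1 where C1: "C1 > 0" and balls: "\<And>(c :: int \<times> nat \<Rightarrow> 'a) \<rho> w.
      (\<forall>i. 0 \<le> \<rho> i) \<and> (\<forall>i. 0 \<le> w i) \<Longrightarrow>
      (\<integral>\<^sup>+t. indicator {0<..} t * hcontent \<beta> {x. ennreal t <
            (\<integral>\<^sup>+i. ennreal (w i) * indicator (ball (c i) (\<rho> i)) x \<partial>count_space UNIV)} \<partial>lborel)
      \<le> ennreal C1 * (\<integral>\<^sup>+i. ennreal (w i * \<rho> i powr \<beta>) \<partial>count_space UNIV)"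
    using hcontent_weighted_balls[OF \<beta>, where 'i="int \<times> nat" and 'a='a] by blast
  have p2: "1 - 2 powr - p > 0" using p powr_less_mono[of "-p" 0 2] by simp
  have p1: "1 - 2 powr - (p - 1) > 0" using p powr_less_mono[of "-(p - 1)" 0 2] by simp
  \<comment> \<open>Here \<open>2 powr p\<close> comes from rounding the mean up to
    \<open>2 powr (m + 1)\<close>, \<open>5 powr n\<close> from the Vitali enlargement, and
    \<open>2 / \<omega>\<close> from truncation at half the height and the volume of the unit
    ball.\<close>
  define B1 where "B1 = C' * 2 powr p * 5 powr n * (2 / \<omega>)"
  have B1: "B1 > 0" using C' \<omega> by (simp add: B1_def)
  \<comment> \<open>The shell bound \<open>2 powr (k + 1)\<close> and a geometric series ending at
    \<open>m = k + 1\<close> together give \<open>2 powr p\<close>; \<omega> is the price of passing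
    from Lebesgue measure to content.\<close>
  define B2 where "B2 = 2 powr p / (1 - 2 powr - (p - 1)) * \<omega>"
  have B2: "B2 > 0" using p1 \<omega> by (simp add: B2_def)
  define C where "C = C1 * B1 * B2 / (1 - 2 powr - p)"
  have C: "C > 0" using C1 B1 B2 p2 by (simp add: C_def)
  have "(\<integral>\<^sup>+t. indicator {0<..} t * hcontent (real DIM('a) - \<kappa> * p) {x. ennreal (A * t powr (1 / p)) < frac_maximal \<kappa> f x} \<partial>lborel)
     \<le> ennreal C * choquet_int (real DIM('a)) UNIV (\<lambda>x. ennreal (f x powr p))" (is "?L \<le> _")
    if f_meas[measurable]: "f \<in> borel_measurable borel" and f: "\<And>x. 0 \<le> f x"
      and int: "(\<integral>\<^sup>+x. ennreal (f x) \<partial>lborel) < \<infinity>" for f :: "'a \<Rightarrow> real"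
  proof -
    define lev where "lev k = {x. 2 powr real_of_int k < f x}" for k
    define H where "H k = hcontent n (lev k)" for k
    define HS where "HS = (\<integral>\<^sup>+k. ennreal (2 powr (real_of_int k * p)) * H k \<partial>count_space UNIV)"
    have HS: "ennreal (1 - 2 powr - p) * HS \<le> choquet_int n UNIV (\<lambda>x. ennreal (f x powr p))"
      unfolding HS_def H_def lev_def by (rule sum_hcontent_levels_le_choquet_int[OF p0 f])
    define If where "If = enn2real (\<integral>\<^sup>+x. ennreal (f x) \<partial>lborel)"
    have If: "(\<integral>\<^sup>+x. ennreal (f x) \<partial>lborel) = ennreal If" "0 \<le> If" using int by (auto simp: If_def less_top)
    have int_le: "(\<integral>\<^sup>+y. ennreal (f y) * indicator S y \<partial>lborel) \<le> ennreal If" for S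
      unfolding If(1)[symmetric] by (intro nn_integral_mono) (auto split: split_indicator)
    \<comment> \<open>A ball of \<open>G m\<close> lies in some \<open>ball (z m j) (5 * r m j)\<close>, so its radius is at most \<open>5 * r m j\<close>: this absorbs the factor \<open>d powr \<kappa>\<close>.\<close>
    define G where "G m = {(x, d). 0 < d \<and> ennreal (2 powr real_of_int m * (\<omega> * d ^ DIM('a)))
        < (\<integral>\<^sup>+y. ennreal (f y) * indicator (cball x d) y \<partial>lborel)}" for m :: int
    have bounded: "0 < d \<and> d \<le> 1 + If / (2 powr real_of_int m * \<omega>)" if "(x, d) \<in> G m" for x d m
    proof
      show d: "0 < d" using that by (simp add: G_def)
      have "ennreal (2 powr real_of_int m * (\<omega> * d ^ DIM('a))) < ennreal If"
        using that int_le[of "cball x d"] by (auto simp: G_def intro: less_le_trans)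
      then have "2 powr real_of_int m * (\<omega> * d ^ DIM('a)) < If" using d \<omega> by (simp add: ennreal_less_iff)
      then have "d ^ DIM('a) < If / (2 powr real_of_int m * \<omega>)" using \<omega> by (simp add: field_simps)
      \<comment> \<open>A crude substitute for taking roots: any bound on the radii will do.\<close>
      moreover have "d \<le> 1 + d ^ DIM('a)"
      proof (cases "d \<le> 1")
        case False
        then have "d ^ 1 \<le> d ^ DIM('a)" by (intro power_increasing) (auto simp: Suc_leI)
        then show ?thesis by simp
      next
        case True
        have "0 \<le> d ^ DIM('a)" using d by simp
        with True show ?thesis by linarith
      qed
      ultimately show "d \<le> 1 + If / (2 powr real_of_int m * \<omega>)" by linarith
    qed
    define Q where "Q m z r \<longleftrightarrow> (\<forall>j::nat. 0 \<le> r j) \<and> (\<forall>j. 0 < r j \<longrightarrow> (z j, r j) \<in> G m) \<and>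
        disjoint_family (\<lambda>j. if 0 < r j then cball (z j) (r j) else {}) \<and>
        (\<forall>x s. (x, s) \<in> G m \<longrightarrow> (\<exists>j. 0 < r j \<and> cball x s \<subseteq> ball (z j) (5 * r j)))" for m z r
    have "\<exists>z r. Q m z r" for m
      unfolding Q_def by (rule Vitali_covering_sequence[of "G m", OF bounded]) blast+
    then obtain z r where Q: "\<And>m. Q m (z m) (r m)" by metis
    have r: "\<And>m j. 0 \<le> r m j" and rG: "\<And>m j. 0 < r m j \<Longrightarrow> (z m j, r m j) \<in> G m"
      and dis: "\<And>m. disjoint_family (\<lambda>j. if 0 < r m j then cball (z m j) (r m j) else {})"
      and cov: "\<And>m x s. (x, s) \<in> G m \<Longrightarrow> \<exists>j. 0 < r m j \<and> cball x s \<subseteq> ball (z m j) (5 * r m j)"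
      using Q unfolding Q_def by simp_all
    \<comment> \<open>\<open>C'\<close> times the \<open>p\<close>-th power of an upper bound for
      \<open>d powr \<kappa>\<close> times the mean of \<open>f\<close> over any ball of radius
      \<open>d\<close> inside the enlarged Vitali ball, when that mean is at most
      \<open>2 powr (m + 1)\<close>.\<close>
    define w where "w = (\<lambda>(m, j). C' * (2 powr (real_of_int m + 1) * (5 * r m j) powr \<kappa>) powr p)"
    define R where "R = (\<lambda>(m, j). 5 * r m j)"
    define c where "c = (\<lambda>(m, j). z m j)"
    have w: "0 \<le> w i" for i using C' by (simp add: w_def split: prod.split)
    have R: "0 \<le> R i" for i using r by (simp add: R_def split: prod.split)
    define F where "F x = (\<integral>\<^sup>+i. ennreal (w i) * indicator (ball (c i) (R i)) x \<partial>count_space UNIV)" for x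
    have key: "frac_maximal \<kappa> f x \<le> ennreal (A * t powr (1 / p))" if t: "0 < t" and Ft: "F x \<le> ennreal t" for x t
    proof -
      have "(\<integral>\<^sup>+y. ennreal (f y) * indicator (ball x d) y \<partial>lborel)
          \<le> ennreal (A * t powr (1 / p)) * ennreal (d powr (real DIM('a) - \<kappa>))" if d: "0 < d" for d
      proof -
        define J where "J = enn2real (\<integral>\<^sup>+y. ennreal (f y) * indicator (cball x d) y \<partial>lborel)"
        have J: "(\<integral>\<^sup>+y. ennreal (f y) * indicator (cball x d) y \<partial>lborel) = ennreal J" "0 \<le> J"
          using int_le[of "cball x d"] by (auto simp: J_def le_less_trans)
        have "J \<le> A * t powr (1 / p) * d powr (n - \<kappa>)"
        proof (cases "J = 0")
          case True
          then show ?thesis using A by simp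
        next
          case False
          \<comment> \<open>The quotient is the mean of \<open>f\<close> over
            \<open>cball x d\<close>; its dyadic height \<open>m\<close> selects the Vitali
            family.\<close>
          then have "0 < J / (\<omega> * d ^ DIM('a))" using J \<omega> d by simp
          then obtain m where m: "2 powr real_of_int m < J / (\<omega> * d ^ DIM('a))" "J / (\<omega> * d ^ DIM('a)) \<le> 2 powr (real_of_int m + 1)"
            using ex_dyadic_level by blast
          have "2 powr real_of_int m * (\<omega> * d ^ DIM('a)) < J" using m(1) \<omega> d by (simp add: pos_less_divide_eq)
          then have "(x, d) \<in> G m" using d J \<omega> by (simp add: G_def ennreal_less_iff)
          then obtain j where j: "0 < r m j" "cball x d \<subseteq> ball (z m j) (5 * r m j)" using cov by blast
          have "x \<in> cball x d" using d by simp
          then have xb: "x \<in> ball (z m j) (5 * r m j)" using j by blast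
          have "dist x (z m j) + d < 5 * r m j" using j(2) d by (simp add: cball_subset_ball_iff)
          then have dr: "d \<le> 5 * r m j" using zero_le_dist[of x "z m j"] by linarith
          have "ennreal (w (m, j)) * indicator (ball (c (m, j)) (R (m, j))) x \<le> F x"
            unfolding F_def by (rule nn_integral_ge_point) simp
          then have "ennreal (w (m, j)) \<le> ennreal t" using Ft xb by (simp add: c_def R_def)
          then have "w (m, j) \<le> t" using t by simp
          then have "(2 powr (real_of_int m + 1) * (5 * r m j) powr \<kappa>) powr p \<le> t / C'"
            using C' by (simp add: w_def field_simps)
          then have "((2 powr (real_of_int m + 1) * (5 * r m j) powr \<kappa>) powr p) powr (1 / p) \<le> (t / C') powr (1 / p)"
            using p by (intro powr_mono2) auto
          then have le: "2 powr (real_of_int m + 1) * (5 * r m j) powr \<kappa> \<le> (t / C') powr (1 / p)"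
            using p by (simp add: powr_powr)
          have "J \<le> 2 powr (real_of_int m + 1) * (\<omega> * d ^ DIM('a))" using m(2) \<omega> d by (simp add: pos_divide_le_eq)
          also have "\<dots> = \<omega> * d powr (n - \<kappa>) * (2 powr (real_of_int m + 1) * d powr \<kappa>)"
            using d by (simp add: powr_diff n_def powr_realpow)
          also have "\<dots> \<le> \<omega> * d powr (n - \<kappa>) * (2 powr (real_of_int m + 1) * (5 * r m j) powr \<kappa>)"
            using \<omega> dr d \<kappa> by (intro mult_left_mono powr_mono2) auto
          also have "\<dots> \<le> \<omega> * d powr (n - \<kappa>) * (t / C') powr (1 / p)"
            using \<omega> by (intro mult_left_mono le) auto
          also have "\<dots> = A * t powr (1 / p) * d powr (n - \<kappa>)"
            using \<omega> A t p C' by (simp add: powr_divide powr_mult C'_def powr_powr)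
          finally show ?thesis .
        qed
        then have "(\<integral>\<^sup>+y. ennreal (f y) * indicator (cball x d) y \<partial>lborel) \<le> ennreal (A * t powr (1 / p) * d powr (n - \<kappa>))"
          unfolding J(1) by (rule ennreal_leI)
        moreover have "(\<integral>\<^sup>+y. ennreal (f y) * indicator (ball x d) y \<partial>lborel) \<le> (\<integral>\<^sup>+y. ennreal (f y) * indicator (cball x d) y \<partial>lborel)"
          by (intro nn_integral_mono) (auto split: split_indicator)
        ultimately show ?thesis using A by (simp add: ennreal_mult n_def)
      qed
      then show ?thesis unfolding frac_maximal_le_iff by blast
    qed
    have sum_j: "(\<Sum>j. ennreal (r m j powr n)) \<le> ennreal (2 / \<omega> * 2 powr - real_of_int m) *
        (\<integral>\<^sup>+y. ennreal (f y) * indicator {y. 2 powr (real_of_int m - 1) < f y} y \<partial>lborel)" for m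
    proof -
      \<comment> \<open>Half the height of \<open>G m\<close>, so that \<open>2 * \<tau>\<close> is
        the lower bound for the means over its balls.\<close>
      define \<tau> where "\<tau> = 2 powr (real_of_int m - 1)"
      have \<tau>: "\<tau> > 0" "2 * \<tau> = 2 powr real_of_int m" by (auto simp: \<tau>_def powr_diff)
      have "(\<Sum>j. ennreal (r m j powr n)) = (\<Sum>j. ennreal (1 / (\<tau> * \<omega>)) * ennreal (\<tau> * (\<omega> * r m j ^ DIM('a))))"
      proof (rule arg_cong[where f=suminf], rule ext)
        fix j
        have "r m j powr n = r m j ^ DIM('a)"
          using r[of m j] by (cases "r m j = 0") (auto simp: n_def powr_realpow)
        then show "ennreal (r m j powr n) = ennreal (1 / (\<tau> * \<omega>)) * ennreal (\<tau> * (\<omega> * r m j ^ DIM('a)))"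
          using \<tau> \<omega> r[of m j] by (simp add: ennreal_mult[symmetric])
      qed
      also have "\<dots> = ennreal (1 / (\<tau> * \<omega>)) * (\<Sum>j. ennreal (\<tau> * (\<omega> * r m j ^ DIM('a))))"
        by (rule ennreal_suminf_cmult)
      also have "\<dots> \<le> ennreal (1 / (\<tau> * \<omega>)) * (\<integral>\<^sup>+y. ennreal (f y) * indicator {y. \<tau> < f y} y \<partial>lborel)"
        unfolding \<omega>_def
      proof (intro mult_left_mono sum_Vitali_balls_le[OF f_meas _ r dis])
        show "ennreal (2 * \<tau> * (unit_ball_vol (real DIM('a)) * r m j ^ DIM('a)))
            < (\<integral>\<^sup>+y. ennreal (f y) * indicator (cball (z m j) (r m j)) y \<partial>lborel)" if "0 < r m j" for j
          using rG[OF that] unfolding \<tau>(2) by (simp add: G_def \<omega>_def)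
      qed (use \<tau> in auto)
      also have "1 / (\<tau> * \<omega>) = 2 / \<omega> * 2 powr - real_of_int m"
        using \<omega> by (simp add: \<tau>_def powr_diff powr_minus field_simps)
      finally show ?thesis unfolding \<tau>_def .
    qed
    have "?L \<le> (\<integral>\<^sup>+t. indicator {0<..} t * hcontent \<beta> {x. ennreal t < F x} \<partial>lborel)"
    proof (rule nn_integral_mono)
      fix t :: real
      show "indicator {0<..} t * hcontent (real DIM('a) - \<kappa> * p) {x. ennreal (A * t powr (1 / p)) < frac_maximal \<kappa> f x}
        \<le> indicator {0<..} t * hcontent \<beta> {x. ennreal t < F x}"
        using key[of t] unfolding \<beta>_def n_def
        by (auto split: split_indicator intro!: hcontent_mono simp: not_le[symmetric])
    qed
    also have "\<dots> \<le> ennreal C1 * (\<integral>\<^sup>+i. ennreal (w i * R i powr \<beta>) \<partial>count_space UNIV)"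
      unfolding F_def by (rule balls) (use R w in blast)
    also have "(\<integral>\<^sup>+i. ennreal (w i * R i powr \<beta>) \<partial>count_space UNIV)
        = (\<integral>\<^sup>+m. (\<integral>\<^sup>+j. ennreal (w (m, j) * R (m, j) powr \<beta>) \<partial>count_space UNIV) \<partial>count_space UNIV)"
      by (rule nn_integral_fst_count_space[symmetric])
    also have "\<dots> \<le> (\<integral>\<^sup>+m. ennreal B1 * (ennreal (2 powr (real_of_int m * (p - 1))) *
        (\<integral>\<^sup>+y. ennreal (f y) * indicator {y. 2 powr (real_of_int m - 1) < f y} y \<partial>lborel)) \<partial>count_space UNIV)"
    proof (rule nn_integral_mono)
      fix m :: int
      let ?I = "\<integral>\<^sup>+y. ennreal (f y) * indicator {y. 2 powr (real_of_int m - 1) < f y} y \<partial>lborel"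
      define D where "D = C' * 2 powr p * 5 powr n * 2 powr (real_of_int m * p)"
      have D: "0 < D" using C' by (simp add: D_def)
      \<comment> \<open>The fractional factor in the weight and the lowered exponent of content
        cancel: \<kappa> * p + \<beta> = n, so the cost of a ball is comparable to its
        volume.\<close>
      have "w (m, j) * R (m, j) powr \<beta> = D * r m j powr n" for j
      proof (cases "r m j = 0")
        case False
        then have r0: "0 < r m j" using r[of m j] by simp
        have "(2 powr (real_of_int m + 1) * (5 * r m j) powr \<kappa>) powr p = 2 powr (real_of_int m * p + p) * (5 * r m j) powr (\<kappa> * p)"
          using r0 by (simp add: powr_mult powr_powr algebra_simps)
        moreover have "(5 * r m j) powr (\<kappa> * p) * (5 * r m j) powr \<beta> = 5 powr n * r m j powr n"
          using r0 by (simp only: powr_add[symmetric]) (simp add: \<beta>_def powr_mult)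
        ultimately show ?thesis by (simp add: w_def R_def D_def powr_add mult.assoc)
      qed (use p \<beta> \<kappa> in \<open>simp add: w_def R_def n_def\<close>)
      then have "(\<integral>\<^sup>+j. ennreal (w (m, j) * R (m, j) powr \<beta>) \<partial>count_space UNIV) = (\<Sum>j. ennreal D * ennreal (r m j powr n))"
        using D by (simp add: nn_integral_count_space_nat ennreal_mult)
      also have "\<dots> = ennreal D * (\<Sum>j. ennreal (r m j powr n))" by (rule ennreal_suminf_cmult)
      also have "\<dots> \<le> ennreal D * (ennreal (2 / \<omega> * 2 powr - real_of_int m) * ?I)"
        by (intro mult_left_mono sum_j) simp
      also have "\<dots> = ennreal (D * (2 / \<omega> * 2 powr - real_of_int m)) * ?I"
        using D \<omega> by (subst ennreal_mult) (simp_all add: mult.assoc)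
      also have "D * (2 / \<omega> * 2 powr - real_of_int m) = B1 * 2 powr (real_of_int m * (p - 1))"
        by (simp add: D_def B1_def powr_minus powr_diff algebra_simps divide_inverse)
      finally show "(\<integral>\<^sup>+j. ennreal (w (m, j) * R (m, j) powr \<beta>) \<partial>count_space UNIV)
          \<le> ennreal B1 * (ennreal (2 powr (real_of_int m * (p - 1))) * ?I)"
        using B1 by (simp add: ennreal_mult mult.assoc)
    qed
    also have "\<dots> = ennreal B1 * (\<integral>\<^sup>+m. ennreal (2 powr (real_of_int m * (p - 1))) *
        (\<integral>\<^sup>+y. ennreal (f y) * indicator {y. 2 powr (real_of_int m - 1) < f y} y \<partial>lborel) \<partial>count_space UNIV)"
      by (rule nn_integral_cmult) simp
    also have "(\<integral>\<^sup>+m. ennreal (2 powr (real_of_int m * (p - 1))) *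
        (\<integral>\<^sup>+y. ennreal (f y) * indicator {y. 2 powr (real_of_int m - 1) < f y} y \<partial>lborel) \<partial>count_space UNIV)
      \<le> (\<integral>\<^sup>+m. (\<integral>\<^sup>+k. ennreal (2 powr (real_of_int m * (p - 1))) * (ennreal (2 powr (real_of_int k + 1)) * emeasure lborel (lev k) * indicator {..k + 1} m) \<partial>count_space UNIV) \<partial>count_space UNIV)"
    proof (rule nn_integral_mono)
      fix m :: int
      have "(\<integral>\<^sup>+y. ennreal (f y) * indicator {y. 2 powr (real_of_int m - 1) < f y} y \<partial>lborel)
        \<le> (\<integral>\<^sup>+k. ennreal (2 powr (real_of_int k + 1)) * emeasure lborel (lev k) * indicator {..k + 1} m \<partial>count_space UNIV)"
        using nn_integral_above_level_le[of f lborel m] by (simp add: lev_def)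
      then show "ennreal (2 powr (real_of_int m * (p - 1))) *
          (\<integral>\<^sup>+y. ennreal (f y) * indicator {y. 2 powr (real_of_int m - 1) < f y} y \<partial>lborel)
        \<le> (\<integral>\<^sup>+k. ennreal (2 powr (real_of_int m * (p - 1))) * (ennreal (2 powr (real_of_int k + 1)) * emeasure lborel (lev k) * indicator {..k + 1} m) \<partial>count_space UNIV)"
        by (subst nn_integral_cmult) (auto intro: mult_left_mono)
    qed
    \<comment> \<open>Exchanging the sums puts the geometric series inside: for fixed
      \<open>k\<close> it runs over \<open>m \<le> k + 1\<close> and converges because
      \<open>p - 1 > 0\<close>.\<close>
    also have "\<dots> = (\<integral>\<^sup>+k. (\<integral>\<^sup>+m. ennreal (2 powr (real_of_int m * (p - 1))) * (ennreal (2 powr (real_of_int k + 1)) * emeasure lborel (lev k) * indicator {..k + 1} m) \<partial>count_space UNIV) \<partial>count_space UNIV)"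
      by (rule nn_integral_count_space_nn_integral) auto
    also have "\<dots> \<le> (\<integral>\<^sup>+k. ennreal B2 * (ennreal (2 powr (real_of_int k * p)) * H k) \<partial>count_space UNIV)"
    proof (rule nn_integral_mono)
      fix k :: int
      have regroup: "ennreal a * (ennreal b * h) * ennreal c = ennreal (a * b * c) * h"
        if "0 \<le> a" "0 \<le> b" "0 \<le> c" for a b c h
        using that by (simp add: ennreal_mult ac_simps)
      have lev: "lev k \<in> sets borel" unfolding lev_def by measurable
      have "(\<integral>\<^sup>+m. ennreal (2 powr (real_of_int m * (p - 1))) * (ennreal (2 powr (real_of_int k + 1)) * emeasure lborel (lev k) * indicator {..k + 1} m) \<partial>count_space UNIV)
        = (\<integral>\<^sup>+m. ennreal (2 powr (real_of_int k + 1)) * emeasure lborel (lev k) * (ennreal (2 powr (real_of_int m * (p - 1))) * indicator {..k + 1} m) \<partial>count_space UNIV)"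
        by (simp add: ac_simps)
      also have "\<dots> = ennreal (2 powr (real_of_int k + 1)) * emeasure lborel (lev k) * (\<integral>\<^sup>+m. ennreal (2 powr (real_of_int m * (p - 1))) * indicator {..k + 1} m \<partial>count_space UNIV)"
        by (rule nn_integral_cmult) simp
      also have "(\<integral>\<^sup>+m. ennreal (2 powr (real_of_int m * (p - 1))) * indicator {..k + 1} m \<partial>count_space UNIV)
          = ennreal (2 powr (real_of_int (k + 1) * (p - 1)) / (1 - 2 powr - (p - 1)))"
        using p by (intro nn_integral_int_geometric) simp
      also have "ennreal (2 powr (real_of_int k + 1)) * emeasure lborel (lev k) * \<dots>
          \<le> ennreal (2 powr (real_of_int k + 1)) * (ennreal \<omega> * H k) * ennreal (2 powr (real_of_int (k + 1) * (p - 1)) / (1 - 2 powr - (p - 1)))"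
        unfolding H_def \<omega>_def n_def by (intro mult_left_mono mult_right_mono emeasure_le_hcontent lev) auto
      also have "\<dots> = ennreal (2 powr (real_of_int k + 1) * \<omega> * (2 powr (real_of_int (k + 1) * (p - 1)) / (1 - 2 powr - (p - 1)))) * H k"
        using \<omega> p1 by (intro regroup) auto
      also have "2 powr (real_of_int k + 1) * \<omega> * (2 powr (real_of_int (k + 1) * (p - 1)) / (1 - 2 powr - (p - 1)))
          = B2 * 2 powr (real_of_int k * p)"
      proof -
        have "2 powr (real_of_int k + 1) * 2 powr (real_of_int (k + 1) * (p - 1)) = 2 powr p * 2 powr (real_of_int k * p)"
          by (simp only: powr_add[symmetric]) (simp add: algebra_simps)
        then show ?thesis by (simp add: B2_def)
      qed
      finally show "(\<integral>\<^sup>+m. ennreal (2 powr (real_of_int m * (p - 1))) * (ennreal (2 powr (real_of_int k + 1)) * emeasure lborel (lev k) * indicator {..k + 1} m) \<partial>count_space UNIV)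
          \<le> ennreal B2 * (ennreal (2 powr (real_of_int k * p)) * H k)"
        using B2 by (simp add: ennreal_mult mult.assoc)
    qed
    also have "\<dots> = ennreal B2 * HS"
      unfolding HS_def by (rule nn_integral_cmult) simp
    finally have "?L \<le> ennreal C1 * (ennreal B1 * (ennreal B2 * HS))" by (simp add: mult_left_mono)
    also have "\<dots> = ennreal (C1 * B1 * B2) * HS"
      using C1 B1 B2 by (simp add: ennreal_mult mult.assoc)
    also have "\<dots> = ennreal C * (ennreal (1 - 2 powr - p) * HS)"
      using C1 B1 B2 p2 p by (simp add: C_def mult.assoc[symmetric] ennreal_mult[symmetric])
    also have "\<dots> \<le> ennreal C * choquet_int n UNIV (\<lambda>x. ennreal (f x powr p))"
      by (intro mult_left_mono HS) simp
    finally show ?thesis unfolding n_def .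
  qed
  then show ?thesis using C by blast
qed

section \<open>The Hardy inequality\<close>

lemma frac_maximal_hcontent:
  fixes \<delta> \<kappa> p A :: real
  assumes \<delta>: "0 < \<delta>" "\<delta> \<le> real DIM('a::euclidean_space)" and \<kappa>: "0 \<le> \<kappa>" "\<kappa> < 1"
    and p: "\<delta> / real DIM('a) < p" and \<kappa>p: "\<kappa> * p < \<delta>" and A: "0 < A"
  shows "\<exists>C>0. \<forall>f::'a \<Rightarrow> real. f \<in> borel_measurable borel \<and> (\<forall>x. 0 \<le> f x) \<and> (\<integral>\<^sup>+x. ennreal (f x) \<partial>lborel) < \<infinity> \<longrightarrow>
     (\<integral>\<^sup>+t. indicator {0<..} t * hcontent (\<delta> - \<kappa> * p) {x. ennreal (A * t powr (1 / p)) < frac_maximal \<kappa> f x} \<partial>lborel)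
     \<le> ennreal C * choquet_int \<delta> UNIV (\<lambda>x. ennreal (f x powr p))"
proof (cases "\<delta> = real DIM('a)")
  case True
  \<comment> \<open>For \<delta> equal to the dimension the lower bound on \<open>p\<close> reads
    \<open>1 < p\<close>.\<close>
  then show ?thesis using frac_maximal_hcontent_dim[where 'a='a, OF \<kappa>(1) _ _ A, of p] p \<kappa>p by simp
next
  case False
  then have "\<delta> < real DIM('a)" using \<delta>(2) by simp
  then show ?thesis
    using frac_maximal_hcontent_below_dim[where 'a='a, OF \<delta>(1) _ \<kappa> p \<kappa>p A] by blast
qed

text \<open>Off its support \<open>u\<close> is 0 on an open set, and derivatives are unique. So
  \<open>D\<close> vanishes outside a compact subset of \<Omega>, which makes \<open>norm D\<close>
  integrable and lets its Choquet integral over \<Omega> be taken over the whole space.\<close>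

lemma C1_0_grad_zero_outside:
  assumes "C1_0_grad \<Omega> u D" "x \<notin> closure {x. u x \<noteq> 0}"
  shows "D x = 0"
proof -
  have "(u has_derivative (\<lambda>h. h \<bullet> D x)) (at x)"
    using assms by (auto simp: C1_0_grad_def gderiv_def)
  moreover have "(u has_derivative (\<lambda>h. 0)) (at x)"
  proof (rule has_derivative_transform_within_open)
    show "((\<lambda>y. 0) has_derivative (\<lambda>h. 0)) (at x)" by simp
    show "open (- closure {x. u x \<noteq> 0})" by (rule open_Compl[OF closed_closure])
    show "0 = u y" if "y \<in> - closure {x. u x \<noteq> 0}" for y
      using that closure_subset[of "{x. u x \<noteq> 0}"] by auto
  qed (use assms in auto)
  ultimately have "(\<lambda>h. h \<bullet> D x) = (\<lambda>h. 0)" by (rule has_derivative_unique)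
  then have "D x \<bullet> D x = 0" by (rule fun_cong)
  then show ?thesis by simp
qed

lemma nn_integral_C1_0_grad_finite:
  fixes D :: "'a::euclidean_space \<Rightarrow> 'a"
  assumes u: "C1_0_grad \<Omega> u D"
  shows "(\<integral>\<^sup>+x. ennreal (norm (D x)) \<partial>lborel) < \<infinity>"
proof -
  define S where "S = closure {x. u x \<noteq> 0}"
  have S: "compact S" and cont: "continuous_on UNIV D" using u by (auto simp: C1_0_grad_def S_def)
  have "compact (D ` S)" using S cont by (meson compact_continuous_image continuous_on_subset top_greatest)
  then obtain b where b: "\<And>x. x \<in> S \<Longrightarrow> norm (D x) \<le> b"
    using compact_imp_bounded bounded_iff by (metis imageI)
  have "(\<integral>\<^sup>+x. ennreal (norm (D x)) \<partial>lborel) \<le> (\<integral>\<^sup>+x. ennreal b * indicator S x \<partial>lborel)"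
    using b C1_0_grad_zero_outside[OF u]
    by (intro nn_integral_mono) (auto simp: S_def split: split_indicator intro: ennreal_leI)
  also have "\<dots> = ennreal b * emeasure lborel S"
    using S by (intro nn_integral_cmult_indicator) (auto simp: borel_compact)
  also have "\<dots> < \<infinity>"
    using emeasure_compact_finite[OF S] by (simp add: ennreal_mult_less_top)
  finally show ?thesis .
qed

theorem theorem3p3:
  fixes \<delta> \<kappa> p b :: real
  assumes "DIM('a::euclidean_space) \<ge> 2"
    and "b > 0"
    and "0 < \<delta>" "\<delta> \<le> real DIM('a)"
    and "0 \<le> \<kappa>" "\<kappa> < 1"
    and "\<delta> / real DIM('a) < p" "\<kappa> = 0 \<or> p < \<delta> / \<kappa>"
  shows "\<exists>c>0. \<forall>(\<Omega>::'a set) u D.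
           open \<Omega> \<and> \<Omega> \<noteq> UNIV \<and> outer_regular \<Omega> b \<and> C1_0_grad \<Omega> u D \<longrightarrow>
           choquet_int (\<delta> - \<kappa> * p) \<Omega>
              (\<lambda>x. ennreal (\<bar>u x\<bar> powr p / infdist x (frontier \<Omega>) powr (p * (1 - \<kappa>))))
           \<le> ennreal c * choquet_int \<delta> \<Omega> (\<lambda>x. ennreal (norm (D x) powr p))"
proof -
  have p: "p > 0" using assms(3,7) by (meson divide_pos_pos less_trans of_nat_0_less_iff DIM_positive)
  have \<kappa>p: "\<kappa> * p < \<delta>" using assms(3,5,8) by (cases "\<kappa> = 0") (auto simp: field_simps)
  \<comment> \<open>Constant of the pointwise estimate, depending on the dimension, \<kappa> and
    \<open>b\<close> only. Taking \<open>A = 1 / c0\<close> in the maximal inequality therefore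
    fixes \<open>C\<close> before \<Omega>, \<open>u\<close> and \<open>D\<close>.\<close>
  define c0 where "c0 = 2 powr (real DIM('a) + 1 - \<kappa>) / (b * (1 - \<kappa>) * unit_ball_vol DIM('a))"
  have c0: "c0 > 0" using assms(2,6) by (simp add: c0_def)
  obtain C where C: "C > 0" and max: "\<And>f::'a \<Rightarrow> real. \<lbrakk>f \<in> borel_measurable borel; \<forall>x. 0 \<le> f x; (\<integral>\<^sup>+x. ennreal (f x) \<partial>lborel) < \<infinity>\<rbrakk> \<Longrightarrow>
     (\<integral>\<^sup>+t. indicator {0<..} t * hcontent (\<delta> - \<kappa> * p) {x. ennreal (1 / c0 * t powr (1 / p)) < frac_maximal \<kappa> f x} \<partial>lborel)
     \<le> ennreal C * choquet_int \<delta> UNIV (\<lambda>x. ennreal (f x powr p))"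
    using frac_maximal_hcontent[where 'a='a, OF assms(3-7) \<kappa>p, of "1 / c0"] c0 by auto
  have "choquet_int (\<delta> - \<kappa> * p) \<Omega>
              (\<lambda>x. ennreal (\<bar>u x\<bar> powr p / infdist x (frontier \<Omega>) powr (p * (1 - \<kappa>))))
           \<le> ennreal C * choquet_int \<delta> \<Omega> (\<lambda>x. ennreal (norm (D x) powr p))"
    if \<Omega>: "open \<Omega>" "\<Omega> \<noteq> UNIV" "outer_regular \<Omega> b" and u: "C1_0_grad \<Omega> u D" for \<Omega> :: "'a set" and u D
  proof -
    define f where "f x = norm (D x)" for x
    have cont: "continuous_on UNIV D" and supp: "closure {x. u x \<noteq> 0} \<subseteq> \<Omega>"
      using u by (auto simp: C1_0_grad_def)
    have f_meas: "f \<in> borel_measurable borel"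
      unfolding f_def by (intro borel_measurable_continuous_onI continuous_intros cont)
    \<comment> \<open>Negating the claim supplies the real upper bound \<open>K\<close> for the
      maximal function that the pointwise estimate asks for; raising the estimate to the power
      \<open>p\<close> bounds the quotient by exactly \<open>t\<close>.\<close>
    have level: "ennreal (1 / c0 * t powr (1 / p)) < frac_maximal \<kappa> f x"
      if x: "x \<in> \<Omega>" and t: "0 < t"
        and gt: "ennreal t < ennreal (\<bar>u x\<bar> powr p / infdist x (frontier \<Omega>) powr (p * (1 - \<kappa>)))" for x t
    proof (rule ccontr)
      assume "\<not> ?thesis"
      then have K: "frac_maximal \<kappa> (\<lambda>y. norm (D y)) x \<le> ennreal (1 / c0 * t powr (1 / p))"
        by (simp add: f_def[abs_def] not_less)
      define d where "d = infdist x (frontier \<Omega>)"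
      have K0: "0 \<le> 1 / c0 * t powr (1 / p)" using c0 by simp
      note ph = pointwise_hardy[OF \<Omega> u x assms(5,6) K0 K, folded c0_def d_def]
      have "\<bar>u x\<bar> \<le> d powr (1 - \<kappa>) * t powr (1 / p)" using ph(2) c0 by simp
      then have "\<bar>u x\<bar> powr p \<le> (d powr (1 - \<kappa>) * t powr (1 / p)) powr p"
        using p by (intro powr_mono2) auto
      also have "\<dots> = d powr (p * (1 - \<kappa>)) * t"
        using t p ph(1) by (simp add: powr_mult powr_powr mult.commute)
      finally have "\<bar>u x\<bar> powr p / d powr (p * (1 - \<kappa>)) \<le> t"
        using ph(1) by (simp add: divide_le_eq mult.commute)
      then show False using gt t by (simp add: d_def ennreal_less_iff)
    qed
    have "choquet_int (\<delta> - \<kappa> * p) \<Omega>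
              (\<lambda>x. ennreal (\<bar>u x\<bar> powr p / infdist x (frontier \<Omega>) powr (p * (1 - \<kappa>))))
      \<le> (\<integral>\<^sup>+t. indicator {0<..} t * hcontent (\<delta> - \<kappa> * p) {x. ennreal (1 / c0 * t powr (1 / p)) < frac_maximal \<kappa> f x} \<partial>lborel)"
      unfolding choquet_int_def
    proof (rule nn_integral_mono)
      fix t :: real
      show "indicator {0<..} t * hcontent (\<delta> - \<kappa> * p) {x \<in> \<Omega>. ennreal t < ennreal (\<bar>u x\<bar> powr p / infdist x (frontier \<Omega>) powr (p * (1 - \<kappa>)))}
        \<le> indicator {0<..} t * hcontent (\<delta> - \<kappa> * p) {x. ennreal (1 / c0 * t powr (1 / p)) < frac_maximal \<kappa> f x}"
      proof (cases "0 < t")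
        case True
        show ?thesis
        proof (intro mult_left_mono hcontent_mono subsetI CollectI)
          show "ennreal (1 / c0 * t powr (1 / p)) < frac_maximal \<kappa> f x"
            if "x \<in> {x \<in> \<Omega>. ennreal t < ennreal (\<bar>u x\<bar> powr p / infdist x (frontier \<Omega>) powr (p * (1 - \<kappa>)))}" for x
            using that by (intro level[OF _ True]) auto
        qed simp
      qed simp
    qed
    also have "\<dots> \<le> ennreal C * choquet_int \<delta> UNIV (\<lambda>x. ennreal (f x powr p))"
      using f_meas nn_integral_C1_0_grad_finite[OF u] by (intro max) (auto simp: f_def)
    also have "choquet_int \<delta> UNIV (\<lambda>x. ennreal (f x powr p)) = choquet_int \<delta> \<Omega> (\<lambda>x. ennreal (norm (D x) powr p))"
    proof -
      have "D x = 0" if "x \<notin> \<Omega>" for x using C1_0_grad_zero_outside[OF u] supp that by blast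
      then have "x \<in> \<Omega>" if "ennreal t < ennreal (norm (D x) powr p)" for x t
        using that by (cases "x \<in> \<Omega>") auto
      then have "{x \<in> UNIV. ennreal t < ennreal (f x powr p)} = {x \<in> \<Omega>. ennreal t < ennreal (norm (D x) powr p)}" for t
        unfolding f_def by blast
      then show ?thesis by (simp add: choquet_int_def)
    qed
    finally show ?thesis .
  qed
  then show ?thesis using C by blast
qed

end
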